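(* Let $\mathbb{F}_q$ be a finite field with $q$ elements and $\operatorname{char}\mathbb{F}_q\ne2$, let $\mathbf{e}$ be a non-square in it, and consider universal conformal geometries $(V,Q,P,L)$ over $\mathbb{F}_q$, with $n=\dim V$ (so the geometry has dimension $n-3$). A quadratic form written as $\sum a_ix_i^2$ is determined by its determinant $\prod a_i$ up to a square, and hence there are two non-isomorphic (non-degenerate) quadratic forms in each dimension. A maximal symplectic subspace is always of dimension at least $n-1$ or $n-2$, whichever is even. The geometry is non-degenerate if and only if $n\ge5$, or $n=4$ and the vector space is symplectic. When the dimension $n-3$ of the geometry is even, the two quadratic forms can be identified by multiplying one by $\mathbf{e}$, and the norms of $P$ and $L$ may each be chosen as either $0$, $1$ or $\mathbf{e}$, giving $9$ geometries. When the dimension is odd, the two quadratic forms are separate, and multiplying by $\mathbf{e}$ does not change the isomorphism class of the form. Only one of the two is symplectic, so if $n=4$ that one must be chosen, while if $n\ge5$ either may be chosen. Unless both $P$ and $L$ have norm $0$, multiplying $Q$ by $\mathbf{e}$ gives different values for the norms of $P$ and $L$, giving $5$ possibilities for the pair $(Q(P),Q(L))$. Therefore, in odd dimension, there are $10$ (non-degenerate) geometries if $n>5$, but only $5$ if $n=4$.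
   Context: For a quadratic form $Q$, $B(u,v)=Q(u+v)-Q(u)-Q(v)$ is the associated bilinear form. A universal conformal geometry of dimension $d$ over a field $\mathbb{K}$ is a tuple $(V,Q,P,L)$ where $V$ is a vector space of dimension $d+3$ over $\mathbb{K}$, $Q$ is a non-degenerate quadratic form with non-degenerate associated bilinear form $B$, and $P,L\in\mathbb{P}V$ are orthogonal with respect to $B$. Geometries are considered up to isomorphism, where $Q$ may be multiplied by any non-zero scalar without altering the isomorphism class. The norm of a point $[v]\in\mathbb{P}V$ is the class of $Q(v)$ in $\mathbb{K}^\times/(\mathbb{K}^\times)^2\cup\{0\}$. A quadratic space (or subspace) of dimension $2m$ is symplectic if its form can be written as $x_1x_2+x_3x_4+\dots+x_{2m-1}x_{2m}$ in some basis. A hypercycle is a $c\in\mathbb{P}V$ with $Q(c)=0$; it is a point if $B(P,c)=0$, a hyperplane if $B(L,c)=0$, and ideal if both hold. The geometry is non-degenerate if there are a non-ideal point $p$ and a non-ideal hyperplane $h$ with $B(p,h)=0$.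
   Formalization: The non-degeneracy criterion is stated for P ≠ L, since a geometry with P = L isotropic is always degenerate (stated as well); the free choice of norms and the count of 9 in even dimension are stated for n ≥ 5, since no geometry with n = 3 is non-degenerate. *)

theory Defs
  imports Complex_Main
begin

text \<open>
  A vector space is a type \<open>'v\<close> with a scalar multiplication \<open>scale\<close> satisfying
  \<^const>\<open>vector_space\<close>. Note that \<open>vector_space.dim scale UNIV = 0\<close> in infinite dimension,
  so a positive value of the dimension entails finite-dimensionality.
\<close>

subsection \<open>Quadratic forms\<close>

definition polar :: "('v::ab_group_add \<Rightarrow> 'k::ab_group_add) \<Rightarrow> 'v \<Rightarrow> 'v \<Rightarrow> 'k" where
  "polar Q u v = Q (u + v) - Q u - Q v"

text \<open>Linearity in one argument suffices for bilinearity, since \<^const>\<open>polar\<close> is symmetric.\<close>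

definition quadratic_form ::
    "('k::field \<Rightarrow> 'v::ab_group_add \<Rightarrow> 'v) \<Rightarrow> ('v \<Rightarrow> 'k) \<Rightarrow> bool" where
  "quadratic_form scale Q \<longleftrightarrow>
     (\<forall>c v. Q (scale c v) = c\<^sup>2 * Q v) \<and>
     (\<forall>u. Vector_Spaces.linear scale (*) (polar Q u))"

text \<open>Non-degeneracy of \<open>B\<close> implies that of \<open>Q\<close> itself (that \<open>Q\<close> has no non-zero zeros in the
  radical of \<open>B\<close>), so it is the only condition imposed.\<close>

definition nondegenerate_form ::
    "('k::field \<Rightarrow> 'v::ab_group_add \<Rightarrow> 'v) \<Rightarrow> ('v \<Rightarrow> 'k) \<Rightarrow> bool" where
  "nondegenerate_form scale Q \<longleftrightarrow>
     quadratic_form scale Q \<and> (\<forall>u. (\<forall>v. polar Q u v = 0) \<longrightarrow> u = 0)"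

definition isometric ::
    "('k::field \<Rightarrow> 'v::ab_group_add \<Rightarrow> 'v) \<Rightarrow> ('k \<Rightarrow> 'w::ab_group_add \<Rightarrow> 'w) \<Rightarrow>
     ('v \<Rightarrow> 'k) \<Rightarrow> ('w \<Rightarrow> 'k) \<Rightarrow> bool" where
  "isometric scale scale' Q Q' \<longleftrightarrow>
     (\<exists>f. Vector_Spaces.linear scale scale' f \<and> bij f \<and> (\<forall>v. Q' (f v) = Q v))"

definition form_classes ::
    "('k::field \<Rightarrow> 'v::ab_group_add \<Rightarrow> 'v) \<Rightarrow> ('v \<Rightarrow> 'k) set set" where
  "form_classes scale =
     {Q. nondegenerate_form scale Q} //
     {(Q, Q'). nondegenerate_form scale Q \<and> nondegenerate_form scale Q' \<and>
               isometric scale scale Q Q'}"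

definition basis_of ::
    "('k::field \<Rightarrow> 'v::ab_group_add \<Rightarrow> 'v) \<Rightarrow> nat \<Rightarrow> (nat \<Rightarrow> 'v) \<Rightarrow> 'v set \<Rightarrow> bool" where
  "basis_of scale n b W \<longleftrightarrow>
     inj_on b {..<n} \<and> \<not> module.dependent scale (b ` {..<n}) \<and>
     module.span scale (b ` {..<n}) = W"

definition diagonal_in ::
    "('k::field \<Rightarrow> 'v::ab_group_add \<Rightarrow> 'v) \<Rightarrow> nat \<Rightarrow> ('v \<Rightarrow> 'k) \<Rightarrow> (nat \<Rightarrow> 'v) \<Rightarrow> (nat \<Rightarrow> 'k) \<Rightarrow> bool" where
  "diagonal_in scale n Q b a \<longleftrightarrow>
     basis_of scale n b UNIV \<and>
     (\<forall>x. Q (\<Sum>i<n. scale (x i) (b i)) = (\<Sum>i<n. a i * (x i)\<^sup>2))"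

text \<open>Coordinates are numbered from 0, so that the form reads
  \<open>x\<^sub>0 x\<^sub>1 + x\<^sub>2 x\<^sub>3 + ...\<close>; the zero subspace (\<open>m = 0\<close>) is symplectic.\<close>

definition symplectic_subspace ::
    "('k::field \<Rightarrow> 'v::ab_group_add \<Rightarrow> 'v) \<Rightarrow> ('v \<Rightarrow> 'k) \<Rightarrow> 'v set \<Rightarrow> bool" where
  "symplectic_subspace scale Q W \<longleftrightarrow>
     (\<exists>m b. basis_of scale (2 * m) b W \<and>
            (\<forall>x. Q (\<Sum>i<2 * m. scale (x i) (b i)) = (\<Sum>j<m. x (2 * j) * x (2 * j + 1))))"

abbreviation symplectic ::
    "('k::field \<Rightarrow> 'v::ab_group_add \<Rightarrow> 'v) \<Rightarrow> ('v \<Rightarrow> 'k) \<Rightarrow> bool" where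
  "symplectic scale Q \<equiv> symplectic_subspace scale Q UNIV"

definition maximal_symplectic_subspace ::
    "('k::field \<Rightarrow> 'v::ab_group_add \<Rightarrow> 'v) \<Rightarrow> ('v \<Rightarrow> 'k) \<Rightarrow> 'v set \<Rightarrow> bool" where
  "maximal_symplectic_subspace scale Q W \<longleftrightarrow>
     symplectic_subspace scale Q W \<and>
     (\<forall>W'. symplectic_subspace scale Q W' \<and> W \<subseteq> W' \<longrightarrow> W' = W)"

subsection \<open>Projective points and norms\<close>

definition proj_points :: "('k::field \<Rightarrow> 'v::ab_group_add \<Rightarrow> 'v) \<Rightarrow> 'v set set" where
  "proj_points scale = {module.span scale {v} | v. v \<noteq> 0}"

definition orthogonal_points ::
    "('v::ab_group_add \<Rightarrow> 'k::ab_group_add) \<Rightarrow> 'v set \<Rightarrow> 'v set \<Rightarrow> bool" where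
  "orthogonal_points Q p r \<longleftrightarrow> (\<forall>u\<in>p. \<forall>v\<in>r. polar Q u v = 0)"

text \<open>The class of \<open>a\<close> in \<open>K\<^sup>\<times>/(K\<^sup>\<times>)\<^sup>2 \<union> {0}\<close>, as a coset.\<close>

definition square_class :: "'k::field \<Rightarrow> 'k set" where
  "square_class a = {c\<^sup>2 * a | c. c \<noteq> 0}"

text \<open>The values of \<open>Q\<close> on the representatives of \<open>[v]\<close> form exactly the class of \<open>Q(v)\<close>; see
  \<open>point_norm_span\<close> below.\<close>

definition point_norm :: "('v::ab_group_add \<Rightarrow> 'k::field) \<Rightarrow> 'v set \<Rightarrow> 'k set" where
  "point_norm Q p = Q ` (p - {0})"

lemma point_norm_span:
  assumes V: "vector_space scale" and Q: "quadratic_form scale Q" and v: "v \<noteq> 0"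
  shows "point_norm Q (module.span scale {v}) = square_class (Q v)"
proof -
  interpret vector_space scale by (rule V)
  have "span {v} - {0} = {scale c v | c. c \<noteq> 0}"
    using v by (auto simp: span_singleton)
  then have "point_norm Q (span {v}) = Q ` (\<lambda>c. scale c v) ` {c. c \<noteq> 0}"
    by (simp add: point_norm_def setcompr_eq_image)
  then show ?thesis
    using Q by (simp add: image_image square_class_def quadratic_form_def setcompr_eq_image)
qed

subsection \<open>Universal conformal geometries\<close>

text \<open>A geometry \<open>(V,Q,P,L)\<close> is a triple \<open>(Q, P, L)\<close>, the space \<open>V\<close> being given by \<open>scale\<close>.\<close>

type_synonym ('k, 'v) geometry = "('v \<Rightarrow> 'k) \<times> 'v set \<times> 'v set"

definition conformal_geometry ::
    "('k::field \<Rightarrow> 'v::ab_group_add \<Rightarrow> 'v) \<Rightarrow> nat \<Rightarrow> ('k, 'v) geometry \<Rightarrow> bool" where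
  "conformal_geometry scale d = (\<lambda>(Q, P, L).
     vector_space scale \<and> vector_space.dim scale UNIV = d + 3 \<and>
     nondegenerate_form scale Q \<and>
     P \<in> proj_points scale \<and> L \<in> proj_points scale \<and> orthogonal_points Q P L)"

definition hypercycle ::
    "('k::field \<Rightarrow> 'v::ab_group_add \<Rightarrow> 'v) \<Rightarrow> ('k, 'v) geometry \<Rightarrow> 'v set \<Rightarrow> bool" where
  "hypercycle scale = (\<lambda>(Q, P, L) c. c \<in> proj_points scale \<and> (\<forall>v\<in>c. Q v = 0))"

definition is_point ::
    "('k::field \<Rightarrow> 'v::ab_group_add \<Rightarrow> 'v) \<Rightarrow> ('k, 'v) geometry \<Rightarrow> 'v set \<Rightarrow> bool" where
  "is_point scale = (\<lambda>(Q, P, L) c. hypercycle scale (Q, P, L) c \<and> orthogonal_points Q P c)"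

definition is_hyperplane ::
    "('k::field \<Rightarrow> 'v::ab_group_add \<Rightarrow> 'v) \<Rightarrow> ('k, 'v) geometry \<Rightarrow> 'v set \<Rightarrow> bool" where
  "is_hyperplane scale = (\<lambda>(Q, P, L) c. hypercycle scale (Q, P, L) c \<and> orthogonal_points Q L c)"

definition is_ideal ::
    "('k::field \<Rightarrow> 'v::ab_group_add \<Rightarrow> 'v) \<Rightarrow> ('k, 'v) geometry \<Rightarrow> 'v set \<Rightarrow> bool" where
  "is_ideal scale G c \<longleftrightarrow> is_point scale G c \<and> is_hyperplane scale G c"

definition nondegenerate_geometry ::
    "('k::field \<Rightarrow> 'v::ab_group_add \<Rightarrow> 'v) \<Rightarrow> nat \<Rightarrow> ('k, 'v) geometry \<Rightarrow> bool" where
  "nondegenerate_geometry scale d G \<longleftrightarrow>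
     conformal_geometry scale d G \<and>
     (\<exists>p h. is_point scale G p \<and> \<not> is_ideal scale G p \<and>
            is_hyperplane scale G h \<and> \<not> is_ideal scale G h \<and>
            orthogonal_points (fst G) p h)"

definition geometry_isomorphic ::
    "('k::field \<Rightarrow> 'v::ab_group_add \<Rightarrow> 'v) \<Rightarrow> ('k \<Rightarrow> 'w::ab_group_add \<Rightarrow> 'w) \<Rightarrow>
     ('k, 'v) geometry \<Rightarrow> ('k, 'w) geometry \<Rightarrow> bool" where
  "geometry_isomorphic scale scale' = (\<lambda>(Q, P, L) (Q', P', L').
     \<exists>f c. Vector_Spaces.linear scale scale' f \<and> bij f \<and> c \<noteq> 0 \<and>
           (\<forall>v. Q' (f v) = c * Q v) \<and> f ` P = P' \<and> f ` L = L')"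

text \<open>Isomorphism classes of non-degenerate geometries of dimension \<open>d\<close> with underlying space
  given by \<open>scale\<close>; since spaces of equal dimension are isomorphic, this represents all of them.\<close>

definition nondegenerate_geometry_classes ::
    "('k::field \<Rightarrow> 'v::ab_group_add \<Rightarrow> 'v) \<Rightarrow> nat \<Rightarrow> ('k, 'v) geometry set set" where
  "nondegenerate_geometry_classes scale d =
     {G. nondegenerate_geometry scale d G} //
     {(G, H). nondegenerate_geometry scale d G \<and> nondegenerate_geometry scale d H \<and>
              geometry_isomorphic scale scale G H}"

definition norm_pair :: "('k::field, 'v::ab_group_add) geometry \<Rightarrow> 'k set \<times> 'k set" where
  "norm_pair = (\<lambda>(Q, P, L). (point_norm Q P, point_norm Q L))"

text \<open>The pairs of norms arising from \<open>(Q, P, L)\<close> when \<open>Q\<close> may be replaced by \<open>e Q\<close>.\<close>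

definition norm_pairs_up_to ::
    "'k::field \<Rightarrow> ('k, 'v::ab_group_add) geometry \<Rightarrow> ('k set \<times> 'k set) set" where
  "norm_pairs_up_to e = (\<lambda>(Q, P, L). {norm_pair (Q, P, L), norm_pair (\<lambda>v. e * Q v, P, L)})"

end

theory Submission
  imports Defs
begin

text \<open>
  Over a finite field of odd characteristic a binary form represents every scalar, so every form is
  \<open>x\<^sub>0\<^sup>2 + \<dots> + d x\<^bsub>n-1\<^esub>\<^sup>2\<close> in some basis, and Witt's theorem (isometries built from reflections) shows
  that \<open>d\<close> is unique up to squares. A geometry with \<open>P \<noteq> L\<close> is non-degenerate iff \<open>P\<close> and \<open>L\<close> lie in two orthogonal
  hyperbolic planes, which forces and is forced by the presence of a 4-dimensional symplectic subspace.
  By Witt's theorem again, the norms of \<open>P\<close> and \<open>L\<close> then determine \<open>(P, L)\<close> up to isometry, and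
  geometries are counted by the determinant of the form together with the pair of norms, modulo
  scaling by \<open>e\<close>.
\<close>

section \<open>Squares in a finite field\<close>

text \<open>The reflection argument for Witt's theorem divides by norms, so it is carried out only
  for orthogonal families of vectors of non-zero norm. The obstacle is that \<open>P\<close> and
  \<open>L\<close> may have norm 0 and then cannot be members of such a family. It is overcome by
  never moving \<open>P\<close> and \<open>L\<close> themselves: inside the two hyperbolic planes
  there is an orthogonal basis with norms 1, -1, 1, -1, whatever the norms of \<open>P\<close> and
  \<open>L\<close>, and the coordinates of \<open>P\<close> and \<open>L\<close> in it depend only
  on \<open>Q P\<close> and \<open>Q L\<close>. Moving one such basis to another therefore moves
  \<open>P\<close> and \<open>L\<close> as well. The same sequence of norms describes symplectic
  subspaces, so one device serves for these, for non-degeneracy and for the orbits.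

  A square factor of \<open>Q\<close> changes neither the determinant class nor the norms of points,
  so the only scalars to compare are 1 and \<open>e\<close>. The factor \<open>e\<close> multiplies
  the determinant by \<open>e ^ n\<close>, which is a square exactly when \<open>n\<close> is even;
  hence the two different counts.\<close>

lemma card_nonzero_squares:
  "card (UNIV :: 'k::{field,finite} set) \<le> 2 * card {x\<^sup>2 | x::'k. x \<noteq> 0} + 1"
proof -
  let ?N = "{x\<^sup>2 | x::'k. x \<noteq> 0}"
  \<comment> \<open>Squaring is at most two-to-one, so the fibres over the non-zero squares,
    together with 0, bound the size of the field.\<close>
  have fibre: "card {x::'k. x\<^sup>2 = s} \<le> 2" if s: "s \<in> ?N" for s
  proof -
    obtain y where "s = y\<^sup>2" using s by auto
    then have "{x. x\<^sup>2 = s} \<subseteq> {y, - y}" by (auto simp: power2_eq_iff)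
    then have "card {x. x\<^sup>2 = s} \<le> card {y, - y}" by (intro card_mono) auto
    also have "\<dots> \<le> 2" by (simp add: card_insert_if)
    finally show ?thesis .
  qed
  have "card (UNIV :: 'k set) \<le> card (insert 0 (\<Union>s\<in>?N. {x::'k. x\<^sup>2 = s}))"
    by (rule card_mono) auto
  also have "\<dots> \<le> Suc (card (\<Union>s\<in>?N. {x::'k. x\<^sup>2 = s}))"
    by (simp add: card_insert_if)
  also have "card (\<Union>s\<in>?N. {x::'k. x\<^sup>2 = s}) \<le> (\<Sum>s\<in>?N. card {x::'k. x\<^sup>2 = s})"
    by (rule card_UN_le) simp
  also have "\<dots> \<le> card ?N * 2" using sum_bounded_above[of ?N "\<lambda>s. card {x. x\<^sup>2 = s}" 2] fibre
    by (metis (mono_tags, lifting) of_nat_id)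
  finally show ?thesis by simp
qed

text \<open>Pigeonhole: the values of \<open>\<alpha> * x^2\<close> and those of
  \<open>c - \<beta> * y^2\<close> each fill more than half of the field, so the two sets
  meet.\<close>

lemma binary_form_universal:
  fixes \<alpha> \<beta> c :: "'k::{field,finite}"
  assumes "\<alpha> \<noteq> 0" "\<beta> \<noteq> 0"
  shows "\<exists>x y. \<alpha> * x\<^sup>2 + \<beta> * y\<^sup>2 = c"
proof (rule ccontr)
  assume none: "\<nexists>x y. \<alpha> * x\<^sup>2 + \<beta> * y\<^sup>2 = c"
  let ?N = "{x\<^sup>2 | x::'k. x \<noteq> 0}" and ?S = "range (\<lambda>x::'k. x\<^sup>2)"
  have "?S = insert 0 ?N" by (auto simp: image_iff)
  moreover have "0 \<notin> ?N" by auto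
  ultimately have "card ?S = card ?N + 1" by simp
  with card_nonzero_squares[where 'k='k] have S: "card (UNIV :: 'k set) + 1 \<le> 2 * card ?S" by simp
  let ?A = "(\<lambda>s. \<alpha> * s) ` ?S" and ?C = "(\<lambda>s. c - \<beta> * s) ` ?S"
  have "card ?A = card ?S" "card ?C = card ?S"
    using assms by (intro card_image inj_onI; simp)+
  moreover have "?A \<inter> ?C = {}"
  proof (rule ccontr)
    assume "?A \<inter> ?C \<noteq> {}"
    then obtain x y where "\<alpha> * x\<^sup>2 = c - \<beta> * y\<^sup>2" by auto
    then have "\<alpha> * x\<^sup>2 + \<beta> * y\<^sup>2 = c" by simp
    with none show False by blast
  qed
  then have "card (?A \<union> ?C) = card ?A + card ?C" by (intro card_Un_disjoint) auto
  moreover have "card (?A \<union> ?C) \<le> card (UNIV :: 'k set)" by (intro card_mono) auto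
  ultimately show False using S by linarith
qed

text \<open>The non-zero squares and their multiples by \<open>e\<close> are disjoint and equally
  many, and each set has at least half of the non-zero elements; together they exhaust the
  multiplicative group.\<close>

lemma square_or_nonsquare_multiple:
  fixes a e :: "'k::{field,finite}"
  assumes e: "\<nexists>x. e = x\<^sup>2" and a: "a \<noteq> 0"
  shows "\<exists>c. c \<noteq> 0 \<and> (a = c\<^sup>2 \<or> a = c\<^sup>2 * e)"
proof -
  let ?N = "{x\<^sup>2 | x::'k. x \<noteq> 0}" and ?E = "(\<lambda>s. s * e) ` {x\<^sup>2 | x::'k. x \<noteq> 0}"
  have e0: "e \<noteq> 0" using e by (metis zero_power2)
  have "card ?E = card ?N" using e0 by (intro card_image inj_onI) simp
  moreover have "?N \<inter> ?E = {}"
  proof (rule ccontr)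
    assume "?N \<inter> ?E \<noteq> {}"
    then obtain s where "s \<in> ?N" "s \<in> ?E" by blast
    then obtain x y where "x\<^sup>2 = y\<^sup>2 * e" "y \<noteq> 0" by auto metis
    then have "e = (x / y)\<^sup>2" by (simp add: field_simps)
    with e show False by blast
  qed
  then have "card (?N \<union> ?E) = card ?N + card ?E" by (intro card_Un_disjoint) auto
  ultimately have "card (UNIV - {0::'k}) \<le> card (?N \<union> ?E)"
    using card_nonzero_squares[where 'k='k] by (simp add: card_Diff_singleton)
  moreover have "?N \<union> ?E \<subseteq> UNIV - {0}" using e0 by auto
  ultimately have "?N \<union> ?E = UNIV - {0}" by (intro card_seteq) auto
  then have "a \<in> ?N \<union> ?E" using a by blast
  then show ?thesis by auto
qed

lemma square_class_eq_iff: "square_class a = square_class b \<longleftrightarrow> (\<exists>c. c \<noteq> 0 \<and> b = c\<^sup>2 * a)"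
proof
  assume "square_class a = square_class b"
  moreover have "b \<in> square_class b" unfolding square_class_def
    by (rule CollectI, rule exI[of _ 1]) simp
  ultimately have "b \<in> square_class a" by simp
  then show "\<exists>c. c \<noteq> 0 \<and> b = c\<^sup>2 * a" by (auto simp: square_class_def)
next
  assume "\<exists>c. c \<noteq> 0 \<and> b = c\<^sup>2 * a"
  then obtain c where c: "c \<noteq> 0" "b = c\<^sup>2 * a" by blast
  have "c'\<^sup>2 * a \<in> square_class b" if "c' \<noteq> 0" for c'
    using c that by (auto simp: square_class_def power2_eq_square intro!: exI[of _ "c' / c"])
  moreover have "c'\<^sup>2 * b \<in> square_class a" if "c' \<noteq> 0" for c'
    using c that by (auto simp: square_class_def power2_eq_square intro!: exI[of _ "c' * c"])
  ultimately show "square_class a = square_class b" unfolding square_class_def by blast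
qed

lemma square_class_mult_cong:
  assumes "square_class a = square_class b"
  shows "square_class (c * a) = square_class (c * b)"
  using assms unfolding square_class_eq_iff by (metis mult.left_commute)

lemma square_class_mult_nonsquare:
  assumes "\<nexists>x. e = x\<^sup>2" "a \<noteq> 0"
  shows "square_class (e * a) \<noteq> square_class a"
proof
  assume "square_class (e * a) = square_class a"
  then obtain c where c: "c \<noteq> 0" "e * a = c\<^sup>2 * a" using square_class_eq_iff by metis
  with assms show False by simp
qed

lemma square_class_cases:
  fixes a e :: "'k::{field,finite}"
  assumes "\<nexists>x. e = x\<^sup>2"
  obtains "a = 0" | "a \<noteq> 0" "square_class a = square_class 1" | "a \<noteq> 0" "square_class a = square_class e"
  using square_or_nonsquare_multiple[OF assms, of a] square_class_eq_iff[of 1 a]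
    square_class_eq_iff[of e a] by fastforce

text \<open>Multiplication by \<open>e\<close> is an involution on square classes, so passing from
  \<open>Q\<close> to \<open>e Q\<close> twice restores all norms.\<close>

lemma square_class_self_mult:
  fixes e :: "'k::field"
  assumes "e \<noteq> 0"
  shows "square_class (e * e * a) = square_class a"
  unfolding square_class_eq_iff using assms
  by (intro exI[of _ "inverse e"]) (simp add: power2_eq_square field_simps)

lemma square_class_distinct:
  fixes e :: "'k::field"
  assumes "\<nexists>x. e = x\<^sup>2"
  shows "square_class 0 \<noteq> square_class 1" "square_class 0 \<noteq> square_class e"
    "square_class 1 \<noteq> square_class e"
  using assms by (auto simp: square_class_eq_iff)

section \<open>Quadratic spaces and orthogonal families\<close>

text \<open>Non-zero norms are part of the notion: they make the family independent and its span
  non-degenerate, so that orthogonal projection onto the span exists. The norms are kept as a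
  separate sequence, so that two families can be compared by sharing it.\<close>

definition orthogonal_family ::
    "('v::ab_group_add \<Rightarrow> 'k::field) \<Rightarrow> nat \<Rightarrow> (nat \<Rightarrow> 'v) \<Rightarrow> (nat \<Rightarrow> 'k) \<Rightarrow> bool" where
  "orthogonal_family Q k b a \<longleftrightarrow>
     (\<forall>i<k. Q (b i) = a i \<and> a i \<noteq> 0) \<and> (\<forall>i<k. \<forall>j<k. i \<noteq> j \<longrightarrow> polar Q (b i) (b j) = 0)"

lemma orthogonal_family_mono: "orthogonal_family Q k b a \<Longrightarrow> l \<le> k \<Longrightarrow> orthogonal_family Q l b a"
  unfolding orthogonal_family_def by auto

lemma orthogonal_family_cong:
  assumes "orthogonal_family Q k b a" "\<And>i. i < k \<Longrightarrow> b i = b' i" "\<And>i. i < k \<Longrightarrow> a i = a' i"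
  shows "orthogonal_family Q k b' a'"
  using assms unfolding orthogonal_family_def by auto

lemma polar_commute: "polar Q u v = polar Q v u"
  by (simp add: polar_def add.commute algebra_simps)

lemma orthogonal_family_Suc:
  assumes "orthogonal_family Q k b a" "\<And>i. i < k \<Longrightarrow> polar Q v (b i) = 0" "Q v = c" "c \<noteq> 0"
  shows "orthogonal_family Q (Suc k) (b(k := v)) (a(k := c))"
  using assms polar_commute[of Q v] unfolding orthogonal_family_def by (auto simp: less_Suc_eq)

locale form_space = vector_space scale
  for scale :: "'k::{field,finite} \<Rightarrow> 'v::ab_group_add \<Rightarrow> 'v" (infixr "*s" 75) +
  fixes Q :: "'v \<Rightarrow> 'k" and n :: nat
  assumes form: "nondegenerate_form scale Q" and dim_UNIV: "dim UNIV = n" and n_pos: "n \<ge> 1"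
    and two: "(2::'k) \<noteq> 0"
begin

abbreviation B where "B \<equiv> polar Q"

lemma four: "(4::'k) \<noteq> 0"
proof -
  have "(4::'k) = 2 * 2" by simp
  then show ?thesis using two by (metis mult_eq_0_iff)
qed

lemma B_add_right: "B u (v + w) = B u v + B u w"
  and B_scale_right: "B u (c *s v) = c * B u v"
  and Q_scale: "Q (c *s v) = c\<^sup>2 * Q v"
  and B_nondegenerate: "(\<And>v. B u v = 0) \<Longrightarrow> u = 0"
  using form unfolding nondegenerate_form_def quadratic_form_def Vector_Spaces.linear_iff by auto

lemma B_add_left: "B (v + w) u = B v u + B w u"
  and B_scale_left: "B (c *s v) u = c * B v u"
  by (simp_all add: polar_commute[of Q _ u] B_add_right B_scale_right)

lemma Q_zero: "Q 0 = 0" using Q_scale[of 0 0] by simp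

lemma B_zero: "B 0 v = 0" "B v 0 = 0" by (simp_all add: polar_def Q_zero)

lemma Q_add: "Q (u + v) = Q u + Q v + B u v" by (simp add: polar_def)

lemma Q_minus: "Q (- v) = Q v" using Q_scale[of "-1" v] by (simp add: scale_minus_left)

lemma B_minus: "B (- u) v = - B u v" "B u (- v) = - B u v"
  using B_scale_left[of "-1" u v] B_scale_right[of u "-1" v] by (simp_all add: scale_minus_left)

lemma B_diff_left: "B (u - v) w = B u w - B v w"
  and B_diff_right: "B w (u - v) = B w u - B w v"
  using B_add_left[of u "- v" w] B_add_right[of w u "- v"] by (simp_all add: B_minus)

lemma B_self: "B v v = 2 * Q v"
proof -
  have "v + v = 2 *s v" using scale_left_distrib[of 1 1 v] by simp
  then show ?thesis by (simp add: polar_def Q_scale power2_eq_square)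
qed

lemma Q_diff: "Q (u - v) = Q u + Q v - B u v"
  using Q_add[of u "- v"] by (simp add: B_minus Q_minus)

lemma B_sum_left: "B (\<Sum>i\<in>I. f i) v = (\<Sum>i\<in>I. B (f i) v)"
  by (induction I rule: infinite_finite_induct) (simp_all add: B_zero B_add_left)

lemmas B_simps = B_add_left B_add_right B_scale_left B_scale_right B_diff_left B_diff_right
  B_minus B_self B_zero
lemmas Q_simps = Q_add Q_diff Q_scale Q_minus Q_zero

section \<open>Coordinates and diagonal bases\<close>

lemma independent_card_le: "independent S \<Longrightarrow> finite S \<and> card S \<le> n"
proof -
  assume S: "independent S"
  obtain T where T: "independent T" "span T = UNIV" "card T = n"
    using basis_exists[of UNIV] dim_UNIV by (metis UNIV_I subset_antisym subset_UNIV)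
  then have "finite T" using n_pos by (metis card.infinite not_one_le_zero)
  then show ?thesis using independent_span_bound[OF _ S, of T] T by auto
qed

lemma independent_full_span:
  assumes "independent S" "card S = n"
  shows "span S = UNIV"
proof (rule ccontr)
  assume "span S \<noteq> UNIV"
  then obtain v where v: "v \<notin> span S" by blast
  then have "v \<notin> S" using span_base by blast
  have "finite S" using assms(1) independent_card_le by blast
  moreover have "independent (insert v S)" by (rule independent_insertI[OF v assms(1)])
  ultimately show False using independent_card_le[of "insert v S"] assms(2) \<open>v \<notin> S\<close> by simp
qed

lemma exists_outside_span:
  assumes "k < n"
  shows "\<exists>v. v \<notin> span (b ` {..<k})"
proof (rule ccontr)
  assume "\<not> ?thesis"
  then have "n \<le> card (b ` {..<k})" using dim_le_card[of UNIV "b ` {..<k}"] dim_UNIV by auto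
  also have "\<dots> \<le> k" using card_image_le[of "{..<k}" b] by simp
  finally show False using assms by simp
qed

lemma independent_familyI:
  fixes k :: nat
  assumes zero: "\<And>x i. (\<Sum>i<k. x i *s b i) = 0 \<Longrightarrow> i < k \<Longrightarrow> x i = 0"
  shows "inj_on b {..<k}" "independent (b ` {..<k})"
proof -
  show inj: "inj_on b {..<k}"
  proof (rule inj_onI, rule ccontr)
    fix i j assume ij: "i \<in> {..<k}" "j \<in> {..<k}" "b i = b j" "i \<noteq> j"
    let ?x = "\<lambda>l. if l = i then 1 else if l = j then -1 else (0::'k)"
    have "(\<Sum>l<k. ?x l *s b l) = (\<Sum>l\<in>{i,j}. ?x l *s b l)"
      using ij by (intro sum.mono_neutral_right) auto
    also have "\<dots> = 0" using ij by (simp add: scale_minus_left)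
    finally show False using zero[of ?x i] ij by simp
  qed
  show "independent (b ` {..<k})"
  proof (rule independent_if_scalars_zero)
    fix f x assume f: "(\<Sum>v\<in>b ` {..<k}. f v *s v) = 0" and x: "x \<in> b ` {..<k}"
    then have "(\<Sum>i<k. f (b i) *s b i) = 0" by (simp add: sum.reindex[OF inj])
    then show "f x = 0" using zero[of "\<lambda>i. f (b i)"] x by auto
  qed simp
qed

lemma span_family:
  fixes k :: nat
  shows "span (b ` {..<k}) = {\<Sum>i<k. x i *s b i | x. True}"
proof (intro equalityI span_minimal)
  show "b ` {..<k} \<subseteq> {\<Sum>i<k. x i *s b i | x. True}"
  proof clarify
    fix j assume j: "j < k"
    have "(\<Sum>i<k. (if i = j then 1 else 0) *s b i) = (\<Sum>i\<in>{j}. b i)"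
      using j by (intro sum.mono_neutral_cong_right) auto
    then show "\<exists>x. b j = (\<Sum>i<k. x i *s b i) \<and> True"
      by (intro exI[of _ "\<lambda>i. if i = j then 1 else 0"]) simp
  qed
  show "subspace {\<Sum>i<k. x i *s b i | x. True}"
  proof (rule subspaceI)
    show "0 \<in> {\<Sum>i<k. x i *s b i | x. True}" by (auto intro!: exI[of _ "\<lambda>_. 0"])
  next
    fix u v assume "u \<in> {\<Sum>i<k. x i *s b i | x. True}" "v \<in> {\<Sum>i<k. x i *s b i | x. True}"
    then obtain x y where "u = (\<Sum>i<k. x i *s b i)" "v = (\<Sum>i<k. y i *s b i)" by auto
    then have "u + v = (\<Sum>i<k. (x i + y i) *s b i)"
      by (simp add: scale_left_distrib sum.distrib)
    then show "u + v \<in> {\<Sum>i<k. x i *s b i | x. True}" by auto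
  next
    fix c u assume "u \<in> {\<Sum>i<k. x i *s b i | x. True}"
    then obtain x where "u = (\<Sum>i<k. x i *s b i)" by auto
    then have "c *s u = (\<Sum>i<k. (c * x i) *s b i)"
      by (simp add: scale_sum_right)
    then show "c *s u \<in> {\<Sum>i<k. x i *s b i | x. True}" by auto
  qed
next
  show "{\<Sum>i<k. x i *s b i | x. True} \<subseteq> span (b ` {..<k})"
    by clarify (intro span_sum span_scale span_base, simp)
qed

lemma orthogonal_coordinate:
  assumes "orthogonal_family Q k b a" "j < k"
  shows "B (\<Sum>i<k. x i *s b i) (b j) = 2 * a j * x j"
proof -
  have "B (\<Sum>i<k. x i *s b i) (b j) = (\<Sum>i<k. x i * B (b i) (b j))"
    by (simp add: B_sum_left B_scale_left)
  also have "\<dots> = (\<Sum>i\<in>{j}. x i * B (b i) (b j))"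
    using assms by (intro sum.mono_neutral_right) (auto simp: orthogonal_family_def)
  finally show ?thesis using assms by (simp add: B_self orthogonal_family_def)
qed

lemma Q_orthogonal_sum:
  assumes "orthogonal_family Q k b a"
  shows "Q (\<Sum>i<k. x i *s b i) = (\<Sum>i<k. a i * (x i)\<^sup>2)"
  using assms
proof (induction k)
  case (Suc k)
  have ortho: "orthogonal_family Q k b a" using Suc.prems by (rule orthogonal_family_mono) simp
  have "B (\<Sum>i<k. x i *s b i) (b k) = (\<Sum>i<k. x i * B (b i) (b k))"
    by (simp add: B_sum_left B_scale_left)
  also have "\<dots> = 0" using Suc.prems by (intro sum.neutral) (auto simp: orthogonal_family_def)
  finally show ?case using Suc.IH[OF ortho] Suc.prems
    by (simp add: Q_add Q_scale B_scale_right orthogonal_family_def mult.commute)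
qed (simp add: Q_zero)

text \<open>A diagonal formula evaluated at one unit vector gives the norms, and at a sum of two
  unit vectors the vanishing of \<open>B\<close>.\<close>

lemma orthogonal_familyI:
  assumes sum: "\<And>x. Q (\<Sum>i<k. x i *s b i) = (\<Sum>i<k. a i * (x i)\<^sup>2)"
    and nz: "\<And>i. i < k \<Longrightarrow> a i \<noteq> 0"
  shows "orthogonal_family Q k b a"
proof -
  have norm: "Q (b i) = a i" if "i < k" for i
  proof -
    let ?x = "\<lambda>l. if l = i then 1 else (0::'k)"
    have "(\<Sum>l<k. ?x l *s b l) = (\<Sum>l\<in>{i}. ?x l *s b l)"
      using that by (intro sum.mono_neutral_right) auto
    moreover have "(\<Sum>l<k. a l * (?x l)\<^sup>2) = (\<Sum>l\<in>{i}. a l * (?x l)\<^sup>2)"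
      using that by (intro sum.mono_neutral_right) auto
    ultimately show ?thesis using sum[of ?x] by simp
  qed
  have "B (b i) (b j) = 0" if "i < k" "j < k" "i \<noteq> j" for i j
  proof -
    let ?x = "\<lambda>l. if l = i \<or> l = j then 1 else (0::'k)"
    have "(\<Sum>l<k. ?x l *s b l) = (\<Sum>l\<in>{i,j}. ?x l *s b l)"
      using that by (intro sum.mono_neutral_right) auto
    moreover have "(\<Sum>l<k. a l * (?x l)\<^sup>2) = (\<Sum>l\<in>{i,j}. a l * (?x l)\<^sup>2)"
      using that by (intro sum.mono_neutral_right) auto
    ultimately show ?thesis using sum[of ?x] that by (simp add: polar_def norm)
  qed
  with norm nz show ?thesis unfolding orthogonal_family_def by auto
qed

lemma orthogonal_family_independent:
  assumes "orthogonal_family Q k b a"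
  shows "inj_on b {..<k}" "independent (b ` {..<k})"
proof -
  have "x j = 0" if "(\<Sum>i<k. x i *s b i) = 0" "j < k" for x j
    using orthogonal_coordinate[OF assms that(2), of x] that assms two
    by (auto simp: B_zero orthogonal_family_def)
  then show "inj_on b {..<k}" "independent (b ` {..<k})" by (rule independent_familyI; blast)+
qed

lemma orthogonal_family_card:
  assumes "orthogonal_family Q k b a"
  shows "card (b ` {..<k}) = k" "k \<le> n"
  using card_image[OF orthogonal_family_independent(1)[OF assms]]
    independent_card_le[OF orthogonal_family_independent(2)[OF assms]] by auto

lemma orthogonal_basis:
  assumes "orthogonal_family Q n b a"
  shows "basis_of scale n b UNIV"
  using orthogonal_family_independent[OF assms] orthogonal_family_card[OF assms]
    independent_full_span unfolding basis_of_def by auto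

text \<open>The factor 2 in the denominators comes from \<open>B v v = 2 * Q v\<close>; for the same
  reason characteristic 2 is excluded.\<close>

lemma orthogonal_expansion:
  assumes "orthogonal_family Q n b a"
  shows "v = (\<Sum>i<n. (B v (b i) / (2 * a i)) *s b i)"
proof -
  have "v \<in> span (b ` {..<n})" using orthogonal_basis[OF assms] by (simp add: basis_of_def)
  then obtain x where x: "v = (\<Sum>i<n. x i *s b i)" unfolding span_family by blast
  have "B v (b i) / (2 * a i) = x i" if "i < n" for i
    using orthogonal_coordinate[OF assms that, of x] that assms two x
    by (auto simp: orthogonal_family_def)
  then show ?thesis using x by simp
qed

lemma diagonal_iff_orthogonal_family:
  "diagonal_in scale n Q b a \<longleftrightarrow> orthogonal_family Q n b a"
proof
  assume "orthogonal_family Q n b a"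
  then show "diagonal_in scale n Q b a"
    unfolding diagonal_in_def using Q_orthogonal_sum orthogonal_basis by blast
next
  assume d: "diagonal_in scale n Q b a"
  then have basis: "basis_of scale n b UNIV"
    and sum: "\<And>x. Q (\<Sum>i<n. x i *s b i) = (\<Sum>i<n. a i * (x i)\<^sup>2)"
    unfolding diagonal_in_def by auto
  \<comment> \<open>A zero coefficient would put \<open>b j\<close> into the radical of
    \<open>B\<close>, so non-degeneracy makes every diagonal basis an orthogonal family.\<close>
  have "a j \<noteq> 0" if j: "j < n" for j
  proof
    assume a: "a j = 0"
    have "B (b j) v = 0" for v
    proof -
      have "v \<in> span (b ` {..<n})" using basis by (simp add: basis_of_def)
      then obtain x where x: "v = (\<Sum>i<n. x i *s b i)" unfolding span_family by blast
      let ?d = "\<lambda>i. if i = j then 1 else (0::'k)"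
      have "(\<Sum>i<n. ?d i *s b i) = (\<Sum>i\<in>{j}. ?d i *s b i)"
        using j by (intro sum.mono_neutral_right) auto
      then have bj: "b j = (\<Sum>i<n. ?d i *s b i)" by simp
      have "b j + v = (\<Sum>i<n. (?d i + x i) *s b i)"
        by (subst bj, subst x) (simp only: scale_left_distrib sum.distrib)
      then have "Q (b j + v) = (\<Sum>i<n. a i * (?d i + x i)\<^sup>2)" using sum by metis
      also have "\<dots> = (\<Sum>i<n. a i * (x i)\<^sup>2)" using a by (intro sum.cong) auto
      finally have "Q (b j + v) = Q v" using sum x by metis
      moreover have "Q (b j) = (\<Sum>i<n. a i * (?d i)\<^sup>2)" using sum bj by metis
      then have "Q (b j) = 0" using a by (simp add: sum.neutral)
      ultimately show ?thesis by (simp add: polar_def)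
    qed
    then have "b j = 0" by (rule B_nondegenerate)
    then have "0 \<in> b ` {..<n}" using j by force
    then show False using basis dependent_zero by (auto simp: basis_of_def)
  qed
  then show "orthogonal_family Q n b a" using sum by (intro orthogonal_familyI)
qed

section \<open>Orthogonal complements and the values that they represent\<close>

lemma orthogonal_projection:
  assumes "orthogonal_family Q k b a"
  obtains s where "s \<in> span (b ` {..<k})" "\<And>i. i < k \<Longrightarrow> B (v - s) (b i) = 0"
proof
  let ?s = "\<Sum>i<k. (B v (b i) / (2 * a i)) *s b i"
  show "?s \<in> span (b ` {..<k})" by (intro span_sum span_scale span_base) auto
  show "B (v - ?s) (b i) = 0" if "i < k" for i
    using orthogonal_coordinate[OF assms that, of "\<lambda>i. B v (b i) / (2 * a i)"] that assms two
    by (simp add: B_diff_left orthogonal_family_def)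
qed

lemma orthogonal_to_span:
  fixes k :: nat
  assumes "\<And>i. i < k \<Longrightarrow> B v (b i) = 0" "s \<in> span (b ` {..<k})"
  shows "B v s = 0"
proof -
  obtain x where "s = (\<Sum>i<k. x i *s b i)" using assms(2) span_family[of b k] by blast
  then have "B s v = (\<Sum>i<k. x i * B v (b i))"
    by (simp add: B_sum_left B_scale_left polar_commute[of Q "b _" v])
  then show ?thesis using assms(1) polar_commute[of Q s v] by simp
qed

text \<open>The form stays non-degenerate on the complement of the family: a vector pairing
  non-trivially with \<open>v\<close> can be projected into the complement without changing that
  pairing, because \<open>v\<close> is orthogonal to what is subtracted.\<close>

lemma complement_nondegenerate:
  assumes fam: "orthogonal_family Q k b a" and v: "v \<noteq> 0" "\<And>i. i < k \<Longrightarrow> B v (b i) = 0"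
  obtains w where "\<And>i. i < k \<Longrightarrow> B w (b i) = 0" "B v w = 1"
proof -
  obtain w where w: "B v w \<noteq> 0" using B_nondegenerate v(1) by blast
  obtain s where s: "s \<in> span (b ` {..<k})" "\<And>i. i < k \<Longrightarrow> B (w - s) (b i) = 0"
    using orthogonal_projection[OF fam] by metis
  have "B v (w - s) = B v w" using orthogonal_to_span[OF v(2) s(1)] by (simp add: B_diff_right)
  then show ?thesis using w s(2)
    by (intro that[of "(1 / B v w) *s (w - s)"]) (auto simp: B_scale_left B_scale_right)
qed

text \<open>Polarization: if \<open>Q\<close> vanished at \<open>v\<close>, \<open>w\<close> and
  \<open>v + w\<close>, then \<open>B v w\<close> would be 0 and not 1.\<close>

lemma complement_anisotropic:
  assumes fam: "orthogonal_family Q k b a" and "k < n"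
  obtains v where "\<And>i. i < k \<Longrightarrow> B v (b i) = 0" "Q v \<noteq> 0"
proof -
  obtain u where u: "u \<notin> span (b ` {..<k})" using exists_outside_span[OF assms(2)] by blast
  obtain s where s: "s \<in> span (b ` {..<k})" "\<And>i. i < k \<Longrightarrow> B (u - s) (b i) = 0"
    using orthogonal_projection[OF fam] by metis
  define v where "v = u - s"
  have "v \<noteq> 0" using u s(1) unfolding v_def by auto
  then obtain w where w: "\<And>i. i < k \<Longrightarrow> B w (b i) = 0" "B v w = 1"
    using complement_nondegenerate[OF fam] s(2) unfolding v_def by metis
  have "Q v \<noteq> 0 \<or> Q w \<noteq> 0 \<or> Q (v + w) \<noteq> 0" using w(2) by (auto simp: Q_add)
  then show ?thesis using s(2) w(1) that unfolding v_def[symmetric]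
    by (metis B_add_left add_0)
qed

text \<open>A complement of dimension at least 2 contains two orthogonal vectors of non-zero norm,
  and the binary form on their plane is universal.\<close>

lemma complement_represents:
  assumes fam: "orthogonal_family Q k b a" and k: "k + 2 \<le> n"
  obtains v where "\<And>i. i < k \<Longrightarrow> B v (b i) = 0" "Q v = c"
proof -
  obtain v where v: "\<And>i. i < k \<Longrightarrow> B v (b i) = 0" "Q v \<noteq> 0"
    using complement_anisotropic[OF fam] k by (metis add_2_eq_Suc' Suc_le_lessD Suc_lessD)
  have fam': "orthogonal_family Q (Suc k) (b(k := v)) (a(k := Q v))"
    using orthogonal_family_Suc[OF fam v(1) refl v(2)] .
  obtain w where w: "\<And>i. i < Suc k \<Longrightarrow> B w ((b(k := v)) i) = 0" "Q w \<noteq> 0"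
    using complement_anisotropic[OF fam'] k by auto
  have wv: "B w v = 0" using w(1)[of k] by simp
  have wb: "B w (b i) = 0" if "i < k" for i using w(1)[of i] that by simp
  obtain x y where xy: "Q v * x\<^sup>2 + Q w * y\<^sup>2 = c"
    using binary_form_universal v(2) w(2) by metis
  show ?thesis
  proof (rule that[of "x *s v + y *s w"])
    show "B (x *s v + y *s w) (b i) = 0" if "i < k" for i
      using v(1) wb that by (simp add: B_simps)
    show "Q (x *s v + y *s w) = c"
      using xy wv polar_commute[of Q v w] by (simp add: Q_simps B_simps mult.commute)
  qed
qed

lemma extend_to_orthogonal_basis:
  assumes "orthogonal_family Q k b a" "k \<le> n"
  shows "\<exists>b' a'. orthogonal_family Q n b' a' \<and> (\<forall>i<k. b' i = b i \<and> a' i = a i)"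
proof -
  have "\<exists>b' a'. orthogonal_family Q (k + d) b' a' \<and> (\<forall>i<k. b' i = b i \<and> a' i = a i)"
    if "k + d \<le> n" for d
    using that
  proof (induction d)
    case (Suc d)
    then obtain b' a' where fam: "orthogonal_family Q (k + d) b' a'" "\<forall>i<k. b' i = b i \<and> a' i = a i"
      by auto
    obtain v where v: "\<And>i. i < k + d \<Longrightarrow> B v (b' i) = 0" "Q v \<noteq> 0"
      using complement_anisotropic[OF fam(1)] Suc.prems by (metis add_Suc_right Suc_le_lessD)
    show ?case
      using orthogonal_family_Suc[OF fam(1) v(1) refl v(2)] fam(2)
      by (intro exI[of _ "b'(k + d := v)"] exI[of _ "a'(k + d := Q v)"]) (simp del: fun_upd_apply, simp)
  qed (use assms in auto)
  from this[of "n - k"] show ?thesis using assms(2) by simp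
qed

lemma exists_orthogonal_basis: "\<exists>b a. orthogonal_family Q n b a"
proof -
  have "orthogonal_family Q 0 (\<lambda>_. 0) (\<lambda>_. 0)" by (simp add: orthogonal_family_def)
  from extend_to_orthogonal_basis[OF this] show ?thesis by auto
qed

end

section \<open>Isometries between quadratic spaces\<close>

definition isometry ::
    "('k::field \<Rightarrow> 'v::ab_group_add \<Rightarrow> 'v) \<Rightarrow> ('k \<Rightarrow> 'w::ab_group_add \<Rightarrow> 'w) \<Rightarrow>
     ('v \<Rightarrow> 'k) \<Rightarrow> ('w \<Rightarrow> 'k) \<Rightarrow> ('v \<Rightarrow> 'w) \<Rightarrow> bool" where
  "isometry scale scale' Q Q' f \<longleftrightarrow>
     Vector_Spaces.linear scale scale' f \<and> bij f \<and> (\<forall>v. Q' (f v) = Q v)"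

lemma isometric_iff: "isometric scale scale' Q Q' \<longleftrightarrow> (\<exists>f. isometry scale scale' Q Q' f)"
  by (simp add: isometric_def isometry_def)

lemma isometry_id: "vector_space scale \<Longrightarrow> isometry scale scale Q Q id"
  by (simp add: isometry_def Vector_Spaces.linear_iff)

lemma isometry_compose:
  assumes "isometry s1 s2 Q1 Q2 f" "isometry s2 s3 Q2 Q3 g"
  shows "isometry s1 s3 Q1 Q3 (g \<circ> f)"
  using assms by (auto simp: isometry_def Vector_Spaces.linear_iff intro: bij_comp)

lemma isometry_inv:
  assumes f: "isometry s1 s2 Q1 Q2 f"
  shows "isometry s2 s1 Q2 Q1 (inv f)"
proof -
  have bij: "bij f" and add: "\<And>u v. f (u + v) = f u + f v" and sc: "\<And>c v. f (s1 c v) = s2 c (f v)"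
    and vs: "vector_space s1" "vector_space s2" and Q: "\<And>v. Q2 (f v) = Q1 v"
    using f by (auto simp: isometry_def Vector_Spaces.linear_iff)
  have inv: "f (inv f w) = w" for w using bij by (simp add: bij_is_surj surj_f_inv_f)
  have inj: "f x = f y \<Longrightarrow> x = y" for x y using bij by (simp add: bij_is_inj inj_eq)
  have "inv f (u + v) = inv f u + inv f v" for u v by (rule inj) (simp add: inv add)
  moreover have "inv f (s2 c v) = s1 c (inv f v)" for c v by (rule inj) (simp add: inv sc)
  moreover have "Q1 (inv f w) = Q2 w" for w using Q[of "inv f w"] inv by simp
  ultimately show ?thesis using vs bij bij_imp_bij_inv
    by (auto simp: isometry_def Vector_Spaces.linear_iff)
qed

lemma isometric_refl: "vector_space scale \<Longrightarrow> isometric scale scale Q Q"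
  using isometry_id isometric_iff by metis

lemma isometric_sym: "isometric s1 s2 Q1 Q2 \<Longrightarrow> isometric s2 s1 Q2 Q1"
  using isometry_inv isometric_iff by metis

lemma isometric_trans: "isometric s1 s2 Q1 Q2 \<Longrightarrow> isometric s2 s3 Q2 Q3 \<Longrightarrow> isometric s1 s3 Q1 Q3"
  using isometry_compose isometric_iff by metis

lemma isometry_polar:
  assumes "isometry s1 s2 Q1 Q2 f"
  shows "polar Q2 (f u) (f v) = polar Q1 u v"
  using assms unfolding isometry_def Vector_Spaces.linear_iff polar_def by metis

lemma isometry_orthogonal_family:
  assumes "isometry s1 s2 Q1 Q2 f" "orthogonal_family Q1 k b a"
  shows "orthogonal_family Q2 k (\<lambda>i. f (b i)) a"
  using assms(2) isometry_polar[OF assms(1)] assms(1)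
  by (simp add: orthogonal_family_def isometry_def)

lemma polar_cmult: "polar (\<lambda>v. c * Q v) u v = c * polar Q u v" for c :: "'k::comm_ring"
  by (simp add: polar_def algebra_simps)

lemma nondegenerate_form_cmult:
  assumes "nondegenerate_form scale Q" "c \<noteq> 0"
  shows "nondegenerate_form scale (\<lambda>v. c * Q v)"
  using assms unfolding nondegenerate_form_def quadratic_form_def Vector_Spaces.linear_iff
  by (auto simp: polar_cmult algebra_simps)

lemma orthogonal_family_cmult:
  assumes "orthogonal_family Q k b a" "c \<noteq> 0"
  shows "orthogonal_family (\<lambda>v. c * Q v) k b (\<lambda>i. c * a i)"
  using assms by (auto simp: orthogonal_family_def polar_cmult)

text \<open>The determinant up to squares, defined without matrices as the set of all \<open>d\<close> for which \<open>Q\<close>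
  is \<open>x\<^sub>0\<^sup>2 + \<dots> + d x\<^bsub>n-1\<^esub>\<^sup>2\<close> in some basis; that this is a single square class follows from
  Witt's theorem.\<close>

definition form_disc :: "nat \<Rightarrow> ('v::ab_group_add \<Rightarrow> 'k::field) \<Rightarrow> 'k set" where
  "form_disc n Q = {d. \<exists>b. orthogonal_family Q n b ((\<lambda>_. 1)(n - 1 := d))}"

section \<open>Reflections, Witt's theorem and the determinant up to squares\<close>

context form_space
begin

lemma form_space_cmult: "c \<noteq> 0 \<Longrightarrow> form_space scale (\<lambda>v. c * Q v) n"
  using nondegenerate_form_cmult[OF form] dim_UNIV n_pos two by unfold_locales

text \<open>The usual factor 2 is absorbed by the polar form, since \<open>B w w = 2 * Q w\<close>;
  thus \<open>w\<close> itself goes to \<open>- w\<close>.\<close>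

definition reflection :: "'v \<Rightarrow> 'v \<Rightarrow> 'v" where
  "reflection w v = v - (B v w / Q w) *s w"

lemma reflection_isometry:
  assumes w: "Q w \<noteq> 0"
  shows "isometry scale scale Q Q (reflection w)"
proof -
  have "reflection w (u + v) = reflection w u + reflection w v" for u v
    by (simp add: reflection_def B_add_left add_divide_distrib scale_left_distrib algebra_simps)
  moreover have "reflection w (c *s v) = c *s reflection w v" for c v
    by (simp add: reflection_def B_scale_left scale_right_diff_distrib)
  moreover have "reflection w (reflection w v) = v" for v
    using w by (simp add: reflection_def B_diff_left B_scale_left B_self algebra_simps
        flip: scale_left_distrib scale_left_diff_distrib add_divide_distrib)
  then have "bij (reflection w)" by (intro involuntory_imp_bij)
  moreover have "Q (reflection w v) = Q v" for v
    using w by (simp add: reflection_def Q_diff B_scale_right Q_scale power2_eq_square)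
  ultimately show ?thesis
    by (simp add: isometry_def Vector_Spaces.linear_iff vector_space_axioms)
qed

lemma reflection_fixes: "B v w = 0 \<Longrightarrow> reflection w v = v"
  by (simp add: reflection_def)

text \<open>If \<open>u - v\<close> has non-zero norm, its reflection exchanges \<open>u\<close> and
  \<open>v\<close>. Otherwise the parallelogram law gives \<open>Q (u + v) = 4 * Q v\<close>, so
  \<open>u + v\<close> can be used instead; its reflection sends \<open>u\<close> to
  \<open>- v\<close>, and the reflection in \<open>v\<close> repairs the sign. Both constructions
  fix whatever is orthogonal to \<open>u\<close> and \<open>v\<close>, which is what an induction
  over a family needs.\<close>

lemma isometry_moving:
  assumes "Q u = Q v" "Q v \<noteq> 0"
  shows "\<exists>f. isometry scale scale Q Q f \<and> f u = v \<and>
             (\<forall>x. B x u = 0 \<and> B x v = 0 \<longrightarrow> f x = x)"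
proof (cases "Q (u - v) = 0")
  case False
  have "B u (u - v) = Q (u - v)" using assms(1) by (simp add: B_diff_right B_self Q_diff)
  then have "reflection (u - v) u = v" using False by (simp add: reflection_def)
  then show ?thesis using reflection_isometry[OF False]
    by (intro exI[of _ "reflection (u - v)"]) (simp add: reflection_fixes B_diff_right)
next
  case True
  then have Buv: "B u v = 2 * Q v" using assms(1) by (simp add: Q_diff)
  then have Q4: "Q (u + v) = 4 * Q v" using assms(1) by (simp add: Q_add)
  then have nz: "Q (u + v) \<noteq> 0" using assms(2) four by simp
  have "B u (u + v) = Q (u + v)" using assms(1) Buv Q4 by (simp add: B_add_right B_self)
  then have "reflection (u + v) u = - v" using nz by (simp add: reflection_def)
  moreover have "reflection v (- v) = v"
    using assms(2) scale_left_distrib[of 1 1 v] by (simp add: reflection_def B_minus B_self scale_minus_left)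
  ultimately show ?thesis
    using isometry_compose[OF reflection_isometry[OF nz] reflection_isometry[OF assms(2)]]
    by (intro exI[of _ "reflection v \<circ> reflection (u + v)"]) (simp add: reflection_fixes B_add_right)
qed

text \<open>Once the first \<open>k\<close> vectors are in place, the image of \<open>b k\<close> is
  moved to \<open>b' k\<close>. The vectors already placed are orthogonal to both, so this last
  isometry leaves them alone.\<close>

theorem witt:
  assumes b: "orthogonal_family Q k b a" and b': "orthogonal_family Q k b' a"
  shows "\<exists>f. isometry scale scale Q Q f \<and> (\<forall>i<k. f (b i) = b' i)"
  using b b'
proof (induction k)
  case 0
  then show ?case using isometry_id[OF vector_space_axioms] by blast
next
  case (Suc k)
  then obtain f where f: "isometry scale scale Q Q f" "\<forall>i<k. f (b i) = b' i"
    using orthogonal_family_mono[of Q "Suc k" _ a k] by auto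
  have fb: "orthogonal_family Q (Suc k) (\<lambda>i. f (b i)) a"
    by (rule isometry_orthogonal_family[OF f(1) Suc.prems(1)])
  then have "Q (f (b k)) = Q (b' k)" "Q (b' k) \<noteq> 0"
    using Suc.prems(2) by (auto simp: orthogonal_family_def)
  then obtain g where g: "isometry scale scale Q Q g" "g (f (b k)) = b' k"
      "\<And>x. B x (f (b k)) = 0 \<and> B x (b' k) = 0 \<Longrightarrow> g x = x"
    using isometry_moving by metis
  have "g (b' i) = b' i" if i: "i < k" for i
  proof (rule g(3))
    have "B (f (b i)) (f (b k)) = 0" "B (b' i) (b' k) = 0"
      using fb Suc.prems(2) i by (auto simp: orthogonal_family_def)
    then show "B (b' i) (f (b k)) = 0 \<and> B (b' i) (b' k) = 0" using f(2) i by simp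
  qed
  then have "\<forall>i<Suc k. (g \<circ> f) (b i) = b' i" using f(2) g(2) by (auto simp: less_Suc_eq)
  then show ?case using isometry_compose[OF f(1) g(1)] by blast
qed

text \<open>Sweeping through the basis, each step works in the plane of two neighbours and trades
  norms \<alpha>, \<beta> for 1, \<alpha>\<beta>, so that the product of all norms passed so far is
  pushed to the right.\<close>

lemma normalize_leading:
  assumes b: "orthogonal_family Q n b a" and "k < n"
  shows "\<exists>b'. orthogonal_family Q n b' (\<lambda>i. if i < k then 1 else if i = k then \<Prod>j\<le>k. a j else a i)"
  using assms(2)
proof (induction k)
  case 0
  have "(\<lambda>i. if i < 0 then 1 else if i = 0 then \<Prod>j\<le>0. a j else a i) = a" by auto
  then show ?case using b by auto
next
  case (Suc k)
  let ?a = "\<lambda>i. if i < k then 1 else if i = k then \<Prod>j\<le>k. a j else a i"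
  obtain b' where b': "orthogonal_family Q n b' ?a" using Suc by auto
  define \<alpha> where "\<alpha> = (\<Prod>j\<le>k. a j)"
  have \<alpha>: "Q (b' k) = \<alpha>" "\<alpha> \<noteq> 0" "Q (b' (Suc k)) = a (Suc k)" "a (Suc k) \<noteq> 0"
    "B (b' k) (b' (Suc k)) = 0" "B (b' (Suc k)) (b' k) = 0"
    using b' Suc.prems unfolding orthogonal_family_def \<alpha>_def by (auto dest: spec[of _ k] spec[of _ "Suc k"])
  obtain x y where xy: "\<alpha> * x\<^sup>2 + a (Suc k) * y\<^sup>2 = 1" using binary_form_universal \<alpha>(2,4) by metis
  define u where "u = x *s b' k + y *s b' (Suc k)"
  \<comment> \<open>The orthogonal complement of \<open>u\<close> in the plane; its norm is the
    product of the two old norms times \<open>Q u\<close>, which is 1.\<close>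
  define w where "w = (a (Suc k) * y) *s b' k - (\<alpha> * x) *s b' (Suc k)"
  have Qu: "Q u = 1" using xy \<alpha> by (simp add: u_def Q_simps B_simps mult.commute)
  have "Q w = a (Suc k) * \<alpha> * (\<alpha> * x\<^sup>2 + a (Suc k) * y\<^sup>2)"
    using \<alpha> by (simp add: w_def Q_simps B_simps power2_eq_square algebra_simps)
  then have Qw: "Q w = \<alpha> * a (Suc k)" using xy by (simp add: mult.commute)
  have "B u w = 0" using \<alpha> by (simp add: u_def w_def B_simps)
  then have Buw: "B u w = 0" "B w u = 0" by (simp_all add: polar_commute[of Q w u])
  have other: "B u (b' i) = 0" "B w (b' i) = 0" "B (b' i) u = 0" "B (b' i) w = 0"
    if "i < n" "i \<noteq> k" "i \<noteq> Suc k" for i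
    using b' that Suc.prems unfolding u_def w_def orthogonal_family_def by (simp_all add: B_simps)
  let ?b = "b'(k := u, Suc k := w)"
  let ?c = "\<lambda>i. if i < Suc k then 1 else if i = Suc k then \<Prod>j\<le>Suc k. a j else a i"
  have "Q (?b i) = ?c i \<and> ?c i \<noteq> 0" if "i < n" for i
    using b' that Qu Qw \<alpha>(2,4) unfolding orthogonal_family_def
    by (auto simp: \<alpha>_def[symmetric])
  moreover have "B (?b i) (?b j) = 0" if "i < n" "j < n" "i \<noteq> j" for i j
    using b' that Buw other unfolding orthogonal_family_def by auto
  ultimately show ?case unfolding orthogonal_family_def by blast
qed

text \<open>Two normalized bases agree in all norms but the last. Witt's theorem carries the first
  \<open>n - 1\<close> vectors of one onto those of the other, and the last vectors then lie on the
  same line, the orthogonal complement of the others. So their norms differ by a square, and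
  conversely rescaling the last vector realizes every square factor.\<close>

lemma form_disc_eq:
  assumes b: "orthogonal_family Q n b a"
  shows "form_disc n Q = square_class (\<Prod>i<n. a i)"
proof -
  let ?one = "\<lambda>d::'k. ((\<lambda>_. 1)(n - 1 := d)) :: nat \<Rightarrow> 'k"
  obtain m where m: "n = Suc m" using n_pos by (cases n) auto
  define p where "p = (\<Prod>i<n. a i)"
  obtain b' where "orthogonal_family Q n b' (\<lambda>i. if i < m then 1 else if i = m then \<Prod>j\<le>m. a j else a i)"
    using normalize_leading[OF b, of m] m by auto
  then have b': "orthogonal_family Q n b' (?one p)"
    by (rule orthogonal_family_cong) (use m in \<open>auto simp: p_def lessThan_Suc_atMost\<close>)
  show ?thesis
  proof (intro equalityI subsetI)
    fix d assume "d \<in> form_disc n Q"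
    then obtain b'' where b'': "orthogonal_family Q n b'' (?one d)" by (auto simp: form_disc_def)
    have "orthogonal_family Q m b'' (\<lambda>_. 1)" "orthogonal_family Q m b' (\<lambda>_. 1)"
      using b'' b' m by (auto simp: orthogonal_family_def)
    then obtain f where f: "isometry scale scale Q Q f" "\<forall>i<m. f (b' i) = b'' i" using witt by metis
    have fb: "orthogonal_family Q n (\<lambda>i. f (b' i)) (?one p)"
      by (rule isometry_orthogonal_family[OF f(1) b'])
    define v where "v = f (b' m)"
    have "B v (b'' i) = 0" if "i < m" for i
      using fb that f(2) m unfolding v_def orthogonal_family_def by (metis lessI less_SucI less_irrefl)
    then have "(\<Sum>i<m. (B v (b'' i) / (2 * ?one d i)) *s b'' i) = 0" by (intro sum.neutral) simp
    then obtain t where t: "v = t *s b'' m" using orthogonal_expansion[OF b'', of v] m by auto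
    have "Q v = p" "p \<noteq> 0" "Q (b'' m) = d" using fb b'' m unfolding v_def orthogonal_family_def by auto
    then have "p = t\<^sup>2 * d" "t \<noteq> 0" using t by (auto simp: Q_scale Q_zero)
    then have "d = (inverse t)\<^sup>2 * p" by (simp add: power2_eq_square field_simps)
    then show "d \<in> square_class (\<Prod>i<n. a i)" using \<open>t \<noteq> 0\<close>
      unfolding square_class_def p_def by (auto intro!: exI[of _ "inverse t"])
  next
    fix d assume "d \<in> square_class (\<Prod>i<n. a i)"
    then obtain c where c: "c \<noteq> 0" "d = c\<^sup>2 * p" by (auto simp: square_class_def p_def)
    have "orthogonal_family Q n (b'(m := c *s b' m)) (?one d)"
      using b' c m unfolding orthogonal_family_def
      by (auto simp: Q_scale B_scale_left B_scale_right)
    then show "d \<in> form_disc n Q" by (auto simp: form_disc_def)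
  qed
qed

lemma form_disc_cases:
  assumes "\<nexists>x. e = x\<^sup>2"
  shows "form_disc n Q = square_class 1 \<or> form_disc n Q = square_class e"
proof -
  obtain b a where b: "orthogonal_family Q n b a" using exists_orthogonal_basis by blast
  then have "(\<Prod>i<n. a i) \<noteq> 0" by (auto simp: orthogonal_family_def)
  then show ?thesis using form_disc_eq[OF b] square_class_cases[OF assms] by metis
qed

lemma form_disc_cmult:
  assumes c: "c \<noteq> 0" and d: "form_disc n Q = square_class d"
  shows "form_disc n (\<lambda>v. c * Q v) = square_class (c ^ n * d)"
proof -
  interpret c: form_space scale "\<lambda>v. c * Q v" n by (rule form_space_cmult[OF c])
  obtain b a where b: "orthogonal_family Q n b a" using exists_orthogonal_basis by blast
  have "form_disc n (\<lambda>v. c * Q v) = square_class (c ^ n * (\<Prod>i<n. a i))"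
    using c.form_disc_eq[OF orthogonal_family_cmult[OF b c]] by (simp add: prod.distrib)
  then show ?thesis using form_disc_eq[OF b] d square_class_mult_cong by metis
qed

text \<open>For even \<open>n\<close> the factor \<open>c ^ n\<close> is the square of
  \<open>c ^ (n/2)\<close>, so no scaling can change the class of the form.\<close>

lemma form_disc_cmult_even:
  assumes "c \<noteq> 0" "even n"
  shows "form_disc n (\<lambda>v. c * Q v) = form_disc n Q"
proof -
  obtain b a where "orthogonal_family Q n b a" using exists_orthogonal_basis by blast
  then have d: "form_disc n Q = square_class (\<Prod>i<n. a i)" by (rule form_disc_eq)
  obtain m where "n = 2 * m" using assms(2) by blast
  then have "c ^ n = (c ^ m)\<^sup>2" by (metis power_mult mult.commute)
  then have "square_class (\<Prod>i<n. a i) = square_class (c ^ n * (\<Prod>i<n. a i))"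
    unfolding square_class_eq_iff using assms(1) by (intro exI[of _ "c ^ m"]) simp
  then show ?thesis using form_disc_cmult[OF assms(1) d] d by metis
qed

text \<open>For odd \<open>n\<close> the factor \<open>c ^ n\<close> is \<open>c\<close> times a
  square, so scaling acts on the determinant as plain multiplication.\<close>

lemma form_disc_cmult_odd:
  assumes c: "c \<noteq> 0" and "odd n" and d: "form_disc n Q = square_class d"
  shows "form_disc n (\<lambda>v. c * Q v) = square_class (c * d)"
proof -
  obtain m where "n = 2 * m + 1" using assms(2) oddE by blast
  then have "c ^ n * d = (c ^ m)\<^sup>2 * (c * d)" by (simp add: power_mult power2_eq_square power_mult_distrib)
  then have "square_class (c * d) = square_class (c ^ n * d)"
    unfolding square_class_eq_iff using c power_not_zero by blast
  then show ?thesis using form_disc_cmult[OF c d] by metis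
qed

end

section \<open>Classification and construction of quadratic forms\<close>

locale form_space_pair = V: form_space scaleV Q n + W: form_space scaleW Q' n
  for scaleV :: "'k::{field,finite} \<Rightarrow> 'v::ab_group_add \<Rightarrow> 'v"
    and scaleW :: "'k \<Rightarrow> 'w::ab_group_add \<Rightarrow> 'w" and Q Q' n
begin

lemma isometry_of_bases:
  assumes b: "orthogonal_family Q n b a" and b': "orthogonal_family Q' n b' a"
  shows "\<exists>f. isometry scaleV scaleW Q Q' f"
proof -
  \<comment> \<open>Both \<open>f\<close> and its inverse \<open>g\<close> transfer coordinates
    between the two bases; extracting coordinates through \<open>polar\<close> makes linearity
    immediate.\<close>
  define f where "f v = (\<Sum>i<n. scaleW (polar Q v (b i) / (2 * a i)) (b' i))" for v
  define g where "g w = (\<Sum>i<n. scaleV (polar Q' w (b' i) / (2 * a i)) (b i))" for w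
  have a: "a i \<noteq> 0" if "i < n" for i using b that by (simp add: orthogonal_family_def)
  have gf: "g (f v) = v" for v
  proof -
    have "g (f v) = (\<Sum>i<n. scaleV (polar Q v (b i) / (2 * a i)) (b i))"
      unfolding g_def f_def using W.orthogonal_coordinate[OF b'] a W.two by (intro sum.cong) auto
    then show ?thesis using V.orthogonal_expansion[OF b, of v] by simp
  qed
  have fg: "f (g w) = w" for w
  proof -
    have "f (g w) = (\<Sum>i<n. scaleW (polar Q' w (b' i) / (2 * a i)) (b' i))"
      unfolding g_def f_def using V.orthogonal_coordinate[OF b] a V.two by (intro sum.cong) auto
    then show ?thesis using W.orthogonal_expansion[OF b', of w] by simp
  qed
  have "bij f" by (rule bij_betw_byWitness[of _ g]) (auto simp: gf fg)
  moreover have "Vector_Spaces.linear scaleV scaleW f"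
    unfolding Vector_Spaces.linear_iff f_def using V.vector_space_axioms W.vector_space_axioms
    by (auto simp: V.B_simps add_divide_distrib W.scale_left_distrib sum.distrib W.scale_sum_right)
  moreover have "Q' (f v) = Q v" for v
  proof -
    have "Q' (f v) = (\<Sum>i<n. a i * (polar Q v (b i) / (2 * a i))\<^sup>2)"
      unfolding f_def by (rule W.Q_orthogonal_sum[OF b'])
    also have "\<dots> = Q v" using V.Q_orthogonal_sum[OF b] V.orthogonal_expansion[OF b, of v] by metis
    finally show ?thesis .
  qed
  ultimately show ?thesis unfolding isometry_def by blast
qed

text \<open>A common element \<open>d\<close> of the two sets provides bases with identical norms 1,
  ..., 1, \<open>d\<close>, and such bases define an isometry.\<close>

theorem isometric_iff_disc:
  "isometric scaleV scaleW Q Q' \<longleftrightarrow> form_disc n Q = form_disc n Q'"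
proof
  assume "isometric scaleV scaleW Q Q'"
  then obtain f where f: "isometry scaleV scaleW Q Q' f" using isometric_iff by blast
  obtain b a where b: "orthogonal_family Q n b a" using V.exists_orthogonal_basis by blast
  show "form_disc n Q = form_disc n Q'"
    using V.form_disc_eq[OF b] W.form_disc_eq[OF isometry_orthogonal_family[OF f b]] by simp
next
  assume disc: "form_disc n Q = form_disc n Q'"
  obtain b a where b: "orthogonal_family Q n b a" using V.exists_orthogonal_basis by blast
  have "(\<Prod>i<n. a i) \<in> form_disc n Q" unfolding V.form_disc_eq[OF b] square_class_def
    by (rule CollectI, rule exI[of _ 1]) simp
  moreover from this have "(\<Prod>i<n. a i) \<in> form_disc n Q'" using disc by simp
  ultimately show "isometric scaleV scaleW Q Q'"
    unfolding form_disc_def isometric_iff using isometry_of_bases by auto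
qed

end

text \<open>The space is abstract, so forms with prescribed norms have to be constructed: the
  diagonal form is pulled back along the coordinates of an enumerated basis. Pairing with a basis
  vector reads off a coordinate up to the factor \<open>2 * a j\<close>, hence
  non-degeneracy.\<close>

lemma exists_form:
  fixes scale :: "'k::{field,finite} \<Rightarrow> 'v::ab_group_add \<Rightarrow> 'v"
  assumes V: "vector_space scale" "vector_space.dim scale UNIV = n" "n \<ge> 1"
    and two: "(2::'k) \<noteq> 0" and a: "\<And>i. i < n \<Longrightarrow> a i \<noteq> 0"
  shows "\<exists>Q b. form_space scale Q n \<and> orthogonal_family Q n b a"
proof -
  interpret vector_space scale by (rule V(1))
  obtain T where T: "independent T" "span T = UNIV" "card T = n"
    using basis_exists[of UNIV] V(2) by (metis UNIV_I subset_antisym subset_UNIV)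
  have finT: "finite T" using T(3) V(3) by (metis card.infinite not_one_le_zero)
  obtain b where b: "bij_betw b {..<n} T" using ex_bij_betw_nat_finite[OF finT] T(3)
    by (auto simp: atLeast0LessThan)
  define r where "r v i = representation T v (b i)" for v i
  have radd: "r (u + v) i = r u i + r v i" and rscale: "r (scale c v) i = c * r v i" for u v c i
    using T by (simp_all add: r_def representation_add representation_scale)
  have rb: "r (b i) j = (if i = j then 1 else 0)" if "i < n" "j < n" for i j
  proof -
    have "b i \<in> T" using b that(1) by (auto simp: bij_betw_def)
    moreover have "b i = b j \<longleftrightarrow> i = j" using b that by (auto simp: bij_betw_def inj_on_eq_iff)
    ultimately show ?thesis using T(1) by (auto simp: r_def representation_basis)
  qed
  define Q where "Q v = (\<Sum>i<n. a i * (r v i)\<^sup>2)" for v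
  have pol: "polar Q u v = (\<Sum>i<n. 2 * a i * r u i * r v i)" for u v
    unfolding polar_def Q_def radd sum_subtractf[symmetric]
    by (intro sum.cong) (auto simp: power2_eq_square algebra_simps)
  have pb: "polar Q u (b j) = 2 * a j * r u j" if "j < n" for u j
  proof -
    have "polar Q u (b j) = (\<Sum>i\<in>{j}. 2 * a i * r u i * r (b j) i)" unfolding pol
      using that rb by (intro sum.mono_neutral_right) auto
    then show ?thesis using rb that by simp
  qed
  have self: "vector_space ((*) :: 'k \<Rightarrow> 'k \<Rightarrow> 'k)" by unfold_locales (simp_all add: algebra_simps)
  have "quadratic_form scale Q"
    unfolding quadratic_form_def Vector_Spaces.linear_iff pol
    using V(1) self
    by (simp add: Q_def radd rscale power_mult_distrib sum_distrib_left sum.distrib algebra_simps)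
  moreover have "u = 0" if "\<And>v. polar Q u v = 0" for u
  proof -
    have "r u j = 0" if "j < n" for j
      using \<open>\<And>v. polar Q u v = 0\<close>[of "b j"] pb[OF that] a[OF that] two by simp
    then have "representation T u x = 0" if "x \<in> T" for x
      using b that unfolding r_def bij_betw_def by auto
    then show ?thesis using sum_representation_eq[OF T(1), of u T] T(2) finT by simp
  qed
  ultimately have "nondegenerate_form scale Q" unfolding nondegenerate_form_def by blast
  then have "form_space scale Q n"
    using V two by (auto simp: form_space_def form_space_axioms_def)
  moreover have "orthogonal_family Q n b a"
    unfolding orthogonal_family_def
  proof (intro conjI allI impI)
    fix i assume i: "i < n"
    have "Q (b i) = (\<Sum>j\<in>{i}. a j * (r (b i) j)\<^sup>2)" unfolding Q_def
      using i rb by (intro sum.mono_neutral_right) auto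
    then show "Q (b i) = a i" using rb i by simp
    show "a i \<noteq> 0" using a i by simp
  next
    fix i j assume "i < n" "j < n" "i \<noteq> j"
    then show "polar Q (b i) (b j) = 0" using pb rb by simp
  qed
  ultimately show ?thesis by blast
qed

section \<open>Symplectic subspaces\<close>

text \<open>The norms of an orthogonal basis of a sum of hyperbolic planes, since
  \<open>x * y\<close> is the difference of the squares of \<open>(x + y)/2\<close> and
  \<open>(x - y)/2\<close>.\<close>

definition alternating :: "nat \<Rightarrow> 'k::field" where
  "alternating i = (if even i then 1 else - 1)"

lemma sum_pairs: "(\<Sum>i<2 * m. f i) = (\<Sum>j<m. f (2 * j) + f (2 * j + 1))"
  for f :: "nat \<Rightarrow> 'a::comm_monoid_add"
  by (induction m) (simp_all add: add.assoc)

lemma prod_alternating: "(\<Prod>i<2 * m. alternating i) = (- 1) ^ m"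
  by (induction m) (simp_all add: alternating_def)

context form_space
begin

text \<open>With \<open>s = 1\<close> this turns a hyperbolic basis into an orthogonal one with norms
  \<open>1, -1, 1, -1, \<dots>\<close>, and \<open>s = 1/2\<close> gives the inverse transformation.\<close>

definition hadamard :: "'k \<Rightarrow> (nat \<Rightarrow> 'v) \<Rightarrow> nat \<Rightarrow> 'v" where
  "hadamard s c i = (if even i then s *s (c i + c (Suc i)) else s *s (c (i - 1) - c i))"

abbreviation hadamard_coords :: "'k \<Rightarrow> (nat \<Rightarrow> 'k) \<Rightarrow> nat \<Rightarrow> 'k" where
  "hadamard_coords s y i \<equiv> (if even i then s * (y i + y (Suc i)) else s * (y (i - 1) - y i))"

lemma double: "v + v = 2 *s v"
  using scale_left_distrib[of 1 1 v] by simp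

text \<open>Sum and difference applied twice double every vector, hence the factor 2 in the
  condition on \<open>s\<close> and \<open>t\<close>.\<close>

lemma hadamard_inverse:
  assumes "s * t * 2 = 1"
  shows "hadamard s (hadamard t c) = c"
proof
  fix i
  have "s *s (t *s (2 *s v)) = v" for v using assms by (simp add: mult.assoc)
  then show "hadamard s (hadamard t c) i = c i"
    by (auto simp: hadamard_def double simp flip: scale_right_distrib scale_right_diff_distrib elim!: oddE)
qed

text \<open>The transformation has a symmetric matrix, so coordinates obey the same rule as basis
  vectors.\<close>

lemma sum_hadamard:
  "(\<Sum>i<2 * m. y i *s hadamard s c i) = (\<Sum>i<2 * m. hadamard_coords s y i *s c i)"
  unfolding sum_pairs hadamard_def
  by (intro sum.cong) (simp_all add: algebra_simps)

lemma span_hadamard_subset: "span (hadamard s c ` {..<2 * m}) \<subseteq> span (c ` {..<2 * m})"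
proof (rule span_minimal)
  show "hadamard s c ` {..<2 * m} \<subseteq> span (c ` {..<2 * m})"
  proof clarify
    fix i assume i: "i < 2 * m"
    have "c j \<in> span (c ` {..<2 * m})" if "j < 2 * m" for j using that by (intro span_base) auto
    moreover have "Suc i < 2 * m" if "even i" using that i by presburger
    ultimately show "hadamard s c i \<in> span (c ` {..<2 * m})"
      using i by (auto simp: hadamard_def intro!: span_scale span_add span_diff)
  qed
qed simp

lemma span_hadamard:
  assumes "s * t * 2 = 1"
  shows "span (hadamard s c ` {..<2 * m}) = span (c ` {..<2 * m})"
  using span_hadamard_subset[of s c m] span_hadamard_subset[of t "hadamard s c" m]
    hadamard_inverse[of t s c] assms by (simp add: mult.commute)

text \<open>Translates hyperbolic bases into orthogonal families, to which the extension lemmas and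
  Witt's theorem apply. In each plane the translation is
  \<open>(y0 + y1) * (y0 - y1) = y0^2 - y1^2\<close>.\<close>

theorem symplectic_subspace_iff:
  "symplectic_subspace scale Q U \<longleftrightarrow>
     (\<exists>m b. orthogonal_family Q (2 * m) b alternating \<and> span (b ` {..<2 * m}) = U)"
proof
  assume "symplectic_subspace scale Q U"
  then obtain m c where c: "basis_of scale (2 * m) c U"
    and Q: "\<And>x. Q (\<Sum>i<2 * m. x i *s c i) = (\<Sum>j<m. x (2 * j) * x (2 * j + 1))"
    unfolding symplectic_subspace_def by auto
  have "Q (\<Sum>i<2 * m. y i *s hadamard 1 c i) = (\<Sum>i<2 * m. alternating i * (y i)\<^sup>2)" for y
    unfolding sum_hadamard unfolding Q unfolding sum_pairs
    by (intro sum.cong) (simp_all add: alternating_def power2_eq_square algebra_simps)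
  then have "orthogonal_family Q (2 * m) (hadamard 1 c) alternating"
    by (rule orthogonal_familyI) (simp add: alternating_def)
  moreover have "span (hadamard 1 c ` {..<2 * m}) = U"
    using span_hadamard[of 1 "1/2"] two c by (simp add: basis_of_def)
  ultimately show "\<exists>m b. orthogonal_family Q (2 * m) b alternating \<and> span (b ` {..<2 * m}) = U"
    by blast
next
  assume "\<exists>m b. orthogonal_family Q (2 * m) b alternating \<and> span (b ` {..<2 * m}) = U"
  then obtain m b where b: "orthogonal_family Q (2 * m) b alternating"
    and U: "span (b ` {..<2 * m}) = U" by blast
  let ?c = "hadamard (1/2) b"
  have "x i = 0" if zero: "(\<Sum>i<2 * m. x i *s ?c i) = 0" and i: "i < 2 * m" for x i
  proof -
    define y where "y = hadamard_coords (1/2) x"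
    have "(\<Sum>i<2 * m. y i *s b i) = 0" using zero unfolding sum_hadamard y_def .
    then have y: "y j = 0" if "j < 2 * m" for j
      using orthogonal_coordinate[OF b that, of y] two by (simp add: B_zero alternating_def split: if_splits)
    show ?thesis
    proof (cases "even i")
      case True
      then have "Suc i < 2 * m" using i by presburger
      then have "y i + y (Suc i) = 0" using y i by simp
      moreover have "y i + y (Suc i) = x i" using True two by (simp add: y_def field_simps)
      ultimately show ?thesis by simp
    next
      case False
      then have "y (i - 1) - y i = 0" using y i by simp
      moreover have "y (i - 1) - y i = x i" using False two four by (auto simp: y_def field_simps elim!: oddE)
      ultimately show ?thesis by simp
    qed
  qed
  then have "inj_on ?c {..<2 * m}" "independent (?c ` {..<2 * m})"
    by (rule independent_familyI; blast)+
  moreover have "span (?c ` {..<2 * m}) = U" using span_hadamard[of "1/2" 1] two U by simp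
  ultimately have "basis_of scale (2 * m) ?c U" by (simp add: basis_of_def)
  moreover have "(16::'k) = 4 * 4" by simp
  then have "(16::'k) \<noteq> 0" using four by (metis mult_eq_0_iff)
  then have "Q (\<Sum>i<2 * m. x i *s ?c i) = (\<Sum>j<m. x (2 * j) * x (2 * j + 1))" for x
    unfolding sum_hadamard unfolding Q_orthogonal_sum[OF b] unfolding sum_pairs using two four
    by (intro sum.cong) (simp_all add: alternating_def power2_eq_square field_simps)
  ultimately show "symplectic_subspace scale Q U" unfolding symplectic_subspace_def by blast
qed

lemma symplectic_iff_alternating:
  "symplectic scale Q \<longleftrightarrow> even n \<and> (\<exists>b. orthogonal_family Q n b alternating)"
proof
  assume "symplectic scale Q"
  then obtain m b where b: "orthogonal_family Q (2 * m) b alternating" "span (b ` {..<2 * m}) = UNIV"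
    using symplectic_subspace_iff by blast
  then have "2 * m = n"
    using orthogonal_family_card(1)[OF b(1)] orthogonal_family_independent(2)[OF b(1)]
      dim_span_eq_card_independent dim_UNIV by metis
  then show "even n \<and> (\<exists>b. orthogonal_family Q n b alternating)" using b(1) by auto
next
  assume "even n \<and> (\<exists>b. orthogonal_family Q n b alternating)"
  then obtain m b where "n = 2 * m" "orthogonal_family Q n b alternating" by blast
  then show "symplectic scale Q"
    using orthogonal_basis symplectic_subspace_iff unfolding basis_of_def by metis
qed

text \<open>The bound leaves a complement of dimension at least 2, which represents the wanted norm.
  The last vector of a full basis is out of reach: there the norm is dictated by the
  determinant.\<close>

lemma extend_alternating:
  assumes "orthogonal_family Q k b alternating" "k + 2 \<le> n"
  shows "\<exists>b'. orthogonal_family Q (Suc k) b' alternating \<and> (\<forall>i<k. b' i = b i)"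
proof -
  obtain v where v: "\<And>i. i < k \<Longrightarrow> B v (b i) = 0" "Q v = alternating k"
    using complement_represents[OF assms] by metis
  have "alternating k \<noteq> (0::'k)" by (simp add: alternating_def)
  then have "orthogonal_family Q (Suc k) (b(k := v)) (alternating(k := alternating k))"
    using orthogonal_family_Suc[OF assms(1) v] by blast
  then show ?thesis by (intro exI[of _ "b(k := v)"]) (simp del: fun_upd_apply, simp)
qed

lemma exists_alternating: "k < n \<Longrightarrow> \<exists>b. orthogonal_family Q k b alternating"
proof (induction k)
  case 0
  then show ?case by (simp add: orthogonal_family_def)
next
  case (Suc k)
  then show ?case using extend_alternating[of k] by auto
qed

lemma maximal_symplectic_dim:
  assumes "maximal_symplectic_subspace scale Q U"
  shows "dim U \<ge> (if even (n - 1) then n - 1 else n - 2)"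
proof -
  obtain m b where b: "orthogonal_family Q (2 * m) b alternating" "span (b ` {..<2 * m}) = U"
    using assms symplectic_subspace_iff unfolding maximal_symplectic_subspace_def by blast
  have dims: "dim (span (c ` {..<k})) = k" if "orthogonal_family Q k c alternating" for k c
    using orthogonal_family_card(1)[OF that] orthogonal_family_independent(2)[OF that]
      dim_span_eq_card_independent by metis
  \<comment> \<open>Extending by two vectors, hence by a whole hyperbolic plane, applies the
    extension lemma at \<open>2 * m\<close> and at \<open>2 * m + 1\<close>, and the second use
    needs \<open>(2 * m + 1) + 2 \<le> n\<close>. The bound on the dimension is then a matter of
    parity.\<close>
  have "\<not> 2 * m + 3 \<le> n"
  proof
    assume m: "2 * m + 3 \<le> n"
    obtain b1 where b1: "orthogonal_family Q (Suc (2 * m)) b1 alternating" "\<forall>i<2 * m. b1 i = b i"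
      using extend_alternating[OF b(1)] m by auto
    obtain b2 where b2: "orthogonal_family Q (Suc (Suc (2 * m))) b2 alternating"
        "\<forall>i<Suc (2 * m). b2 i = b1 i"
      using extend_alternating[OF b1(1)] m by auto
    let ?U = "span (b2 ` {..<2 * Suc m})"
    have fam: "orthogonal_family Q (2 * Suc m) b2 alternating" using b2(1) by simp
    have "symplectic_subspace scale Q ?U" using symplectic_subspace_iff fam by blast
    moreover have "b ` {..<2 * m} = b2 ` {..<2 * m}" using b1(2) b2(2) by (intro image_cong) auto
    then have "U \<subseteq> ?U" unfolding b(2)[symmetric] by (auto intro!: span_mono)
    ultimately have "?U = U" using assms unfolding maximal_symplectic_subspace_def by blast
    then show False using dims[OF fam] dims[OF b(1)] b(2) by simp
  qed
  moreover have "dim U = 2 * m" using dims[OF b(1)] b(2) by simp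
  ultimately show ?thesis by presburger
qed

text \<open>The value \<open>(- 1) ^ m\<close> is the product of the alternating norms. For the
  converse a model form with these norms is built on the same space, and an isometry from it carries
  its basis over.\<close>

lemma symplectic_iff_disc:
  assumes m: "n = 2 * m"
  shows "symplectic scale Q \<longleftrightarrow> form_disc n Q = square_class ((- 1) ^ m)"
proof -
  have "\<exists>Q' b. form_space scale Q' n \<and> orthogonal_family Q' n b (alternating :: nat \<Rightarrow> 'k)"
    using exists_form[OF vector_space_axioms dim_UNIV n_pos two] by (simp add: alternating_def)
  then obtain Q' b where Q': "form_space scale Q' n" and b: "orthogonal_family Q' n b alternating"
    by blast
  interpret Q': form_space scale Q' n by (rule Q')
  interpret pair: form_space_pair scale scale Q' Q n ..
  have disc: "form_disc n Q' = square_class ((- 1) ^ m)"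
    using Q'.form_disc_eq[OF b] prod_alternating m by metis
  show ?thesis
  proof
    assume "symplectic scale Q"
    then obtain b where "orthogonal_family Q n b alternating" using symplectic_iff_alternating by blast
    then show "form_disc n Q = square_class ((- 1) ^ m)" using form_disc_eq prod_alternating m by metis
  next
    assume "form_disc n Q = square_class ((- 1) ^ m)"
    then obtain f where "isometry scale scale Q' Q f"
      using pair.isometric_iff_disc disc isometric_iff by metis
    then have "orthogonal_family Q n (\<lambda>i. f (b i)) alternating"
      using isometry_orthogonal_family b by blast
    then show "symplectic scale Q" using symplectic_iff_alternating m by auto
  qed
qed

end

section \<open>Frames\<close>

text \<open>A geometry is non-degenerate exactly when \<open>P\<close>, \<open>L\<close> complete to a frame, with \<open>p\<close> a point and
  \<open>h\<close> a hyperplane; then \<open>P, h\<close> and \<open>L, p\<close> span two orthogonal hyperbolic planes.\<close>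

definition frame :: "('v::ab_group_add \<Rightarrow> 'k::field) \<Rightarrow> 'v \<Rightarrow> 'v \<Rightarrow> 'v \<Rightarrow> 'v \<Rightarrow> bool" where
  "frame Q P L p h \<longleftrightarrow> Q p = 0 \<and> Q h = 0 \<and> polar Q P L = 0 \<and> polar Q P p = 0 \<and> polar Q L h = 0 \<and>
     polar Q p h = 0 \<and> polar Q P h = 1 \<and> polar Q L p = 1"

lemma frame_swap: "frame Q P L p h \<Longrightarrow> frame Q L P h p"
  by (simp add: frame_def polar_commute[of Q L P] polar_commute[of Q h p])

lemma frame_isometry_image:
  assumes "isometry s1 s2 Q Q' f" "frame Q P L p h"
  shows "frame Q' (f P) (f L) (f p) (f h)"
  using assms(2) isometry_polar[OF assms(1)] assms(1) by (simp add: frame_def isometry_def)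

lemma orthogonal_family_nth_two:
  assumes "Q u = a 0" "Q v = a 1" "a 0 \<noteq> 0" "a 1 \<noteq> 0" "polar Q u v = 0"
  shows "orthogonal_family Q 2 (\<lambda>i. [u, v] ! i) a"
  using assms polar_commute[of Q u v] by (auto simp: orthogonal_family_def less_2_cases_iff)

context form_space
begin

text \<open>In the plane of \<open>P\<close> and \<open>h\<close> the vector
  \<open>P - Q P *s h\<close> is isotropic and still pairs to 1 with \<open>h\<close>; its sum and
  difference with \<open>h\<close> therefore have norms 1 and -1. The same is done with
  \<open>L\<close> and \<open>p\<close>.\<close>

definition frame_family :: "'v \<Rightarrow> 'v \<Rightarrow> 'v \<Rightarrow> 'v \<Rightarrow> nat \<Rightarrow> 'v" where
  "frame_family P L p h i =
     [P - Q P *s h + h, P - Q P *s h - h, L - Q L *s p + p, L - Q L *s p - p] ! i"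

lemma frame_family_orthogonal:
  assumes "frame Q P L p h"
  shows "orthogonal_family Q 4 (frame_family P L p h) alternating"
proof -
  have fr: "Q p = 0" "Q h = 0" "B P L = 0" "B P p = 0" "B L h = 0" "B p h = 0" "B P h = 1" "B L p = 1"
    using assms by (auto simp: frame_def)
  then have "B L P = 0" "B p P = 0" "B h L = 0" "B h p = 0" "B h P = 1" "B p L = 1"
    using polar_commute by metis+
  note fr = fr this
  have less4: "i < 4 \<longleftrightarrow> i = 0 \<or> i = 1 \<or> i = 2 \<or> i = (3::nat)" for i by auto
  show ?thesis
    unfolding orthogonal_family_def
    using fr by (auto simp: less4 frame_family_def alternating_def Q_simps B_simps numeral_3_eq_3)
qed

text \<open>\<open>P\<close> and \<open>L\<close> are combinations of the frame family with
  coefficients depending only on \<open>Q P\<close> and \<open>Q L\<close>. If these norms agree,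
  matching the families already matches \<open>P\<close> and \<open>L\<close>, isotropic or
  not.\<close>

lemma frame_family_recover:
  assumes "isometry scale scale Q Q f"
    and "\<forall>i<4. f (frame_family P L p h i) = frame_family P' L' p' h' i"
    and "Q P = Q P'" "Q L = Q L'"
  shows "f P = P'" "f L = L'"
proof -
  have add: "f (u + v) = f u + f v" and sc: "f (c *s v) = c *s f v" for u v c
    using assms(1) by (auto simp: isometry_def Vector_Spaces.linear_iff)
  have lin: "f ((1/2) *s (u + w) + (q/2) *s (u + (- 1) *s w)) =
      (1/2) *s (f u + f w) + (q/2) *s (f u + (- 1) *s f w)" for u w q
    by (simp only: add sc)
  \<comment> \<open>Half the sum of the two vectors is \<open>x - q *s y\<close> and half their
    difference is \<open>y\<close>. The difference is written with \<open>(- 1) *s\<close>, so that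
    additivity and homogeneity of \<open>f\<close> suffice to map it.\<close>
  have rec: "x = (1/2) *s ((x - q *s y + y) + (x - q *s y - y))
      + (q/2) *s ((x - q *s y + y) + (- 1) *s (x - q *s y - y))" for x y q
  proof -
    have "(x - q *s y + y) + (x - q *s y - y) = 2 *s (x - q *s y)"
      "(x - q *s y + y) + (- 1) *s (x - q *s y - y) = 2 *s y"
      by (simp_all add: double[symmetric] scale_minus_left)
    then show ?thesis using two by simp
  qed
  have f0: "f (P - Q P *s h + h) = P' - Q P *s h' + h'" "f (P - Q P *s h - h) = P' - Q P *s h' - h'"
    "f (L - Q L *s p + p) = L' - Q L *s p' + p'" "f (L - Q L *s p - p) = L' - Q L *s p' - p'"
    using assms(2)[rule_format, of 0] assms(2)[rule_format, of 1] assms(2)[rule_format, of 2]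
      assms(2)[rule_format, of 3] assms(3,4)
    by (simp_all add: frame_family_def numeral_3_eq_3)
  show "f P = P'"
    using lin[of "P - Q P *s h + h" "P - Q P *s h - h" "Q P", folded rec] f0 rec[of P' "Q P" h'] by simp
  show "f L = L'"
    using lin[of "L - Q L *s p + p" "L - Q L *s p - p" "Q L", folded rec] f0 rec[of L' "Q L" p'] by simp
qed

theorem frame_isometry:
  assumes "frame Q P L p h" "frame Q P' L' p' h'" "Q P = Q P'" "Q L = Q L'"
  shows "\<exists>f. isometry scale scale Q Q f \<and> f P = P' \<and> f L = L'"
  using witt[OF frame_family_orthogonal[OF assms(1)] frame_family_orthogonal[OF assms(2)]]
    frame_family_recover[OF _ _ assms(3,4)] by metis

text \<open>Half sums and half differences give two orthogonal hyperbolic pairs \<open>x\<close>,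
  \<open>h\<close> and \<open>y\<close>, \<open>p\<close>. Along the line \<open>x + t *s h\<close>
  the norm is exactly \<open>t\<close>, so any two norms can be prescribed.\<close>

lemma exists_frame:
  assumes "orthogonal_family Q 4 b alternating"
  shows "\<exists>P L p h. frame Q P L p h \<and> Q P = \<alpha> \<and> Q L = \<beta>"
proof -
  have ortho: "B (b i) (b j) = 0" if "i < 4" "j < 4" "i \<noteq> j" for i j
    using assms that by (auto simp: orthogonal_family_def)
  have norms: "Q (b 0) = 1" "Q (b (Suc 0)) = - 1" "Q (b 2) = 1" "Q (b 3) = - 1"
    using assms by (auto simp: orthogonal_family_def alternating_def)
  define x h y p where "x = (1/2) *s (b 0 + b 1)" and "h = (1/2) *s (b 0 - b 1)"
    and "y = (1/2) *s (b 2 + b 3)" and "p = (1/2) *s (b 2 - b 3)"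
  have Q: "Q x = 0" "Q h = 0" "Q y = 0" "Q p = 0"
    by (simp_all add: x_def h_def y_def p_def Q_simps ortho norms)
  have B1: "B x h = 1" "B y p = 1"
    using two four by (simp_all add: x_def h_def y_def p_def B_simps ortho norms)
  have B0: "B x y = 0" "B x p = 0" "B h y = 0" "B h p = 0"
    by (simp_all add: x_def h_def y_def p_def B_simps ortho)
  have B0': "B y x = 0" "B p x = 0" "B y h = 0" "B p h = 0"
    using B0 polar_commute by metis+
  have "frame Q (x + \<alpha> *s h) (y + \<beta> *s p) p h"
    by (simp add: frame_def B_simps Q B0 B0' B1)
  moreover have "Q (x + \<alpha> *s h) = \<alpha>" "Q (y + \<beta> *s p) = \<beta>"
    by (simp_all add: Q_simps B_simps Q B1)
  ultimately show ?thesis by blast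
qed

section \<open>Completing orthogonal vectors to a frame\<close>

lemma hyperbolic_partner:
  assumes "Q P = 0" "B P w = 1"
  shows "Q (w - Q w *s P) = 0" "B P (w - Q w *s P) = 1"
  using assms by (simp_all add: Q_simps B_simps polar_commute[of Q w P])

lemma hyperbolic_pair_norms:
  assumes "Q P = 0" "Q h = 0" "B P h = 1"
  shows "Q (P + h) = 1" "Q (P - h) = - 1" "B (P + h) (P - h) = 0"
  using assms by (simp_all add: Q_simps B_simps polar_commute[of Q h P])

text \<open>A suitable \<open>h\<close> can be chosen directly in the complement of
  \<open>L\<close>, but a direct choice of \<open>p\<close> would need an isotropic vector in a
  prescribed complement. Instead a model frame with the same norms is moved here by Witt's theorem:
  \<open>L\<close>, \<open>P + h\<close>, \<open>P - h\<close> are orthogonal with non-zero norms,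
  and \<open>P\<close> is recovered as half the sum of the last two.\<close>

lemma frame_completion_isotropic_anisotropic:
  assumes b: "orthogonal_family Q 4 b alternating"
    and P: "Q P = 0" "P \<noteq> 0" and L: "Q L \<noteq> 0" and PL: "B P L = 0"
  shows "\<exists>p h. frame Q P L p h"
proof -
  obtain P' L' p' h' where fr: "frame Q P' L' p' h'" "Q P' = 0" "Q L' = Q L"
    using exists_frame[OF b] by metis
  let ?a = "\<lambda>i. [Q L, 1, - 1] ! i" and ?b = "\<lambda>P L h i. [L, P + h, P - h] ! i"
  have fam: "orthogonal_family Q 3 (?b P L h) ?a"
    if "Q P = 0" "Q h = 0" "B P h = 1" "B P L = 0" "B L h = 0" "Q L = q" "?a 0 = q" for P L h q
  proof -
    have less3: "i < 3 \<longleftrightarrow> i = 0 \<or> i = 1 \<or> i = (2::nat)" for i by auto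
    have ortho: "B L (P + h) = 0" "B L (P - h) = 0"
      using that by (simp_all add: B_simps polar_commute[of Q L P])
    then have "B (P + h) L = 0" "B (P - h) L = 0" "B (P - h) (P + h) = 0"
      using hyperbolic_pair_norms(3)[OF that(1-3)] polar_commute by metis+
    with ortho show ?thesis using hyperbolic_pair_norms[OF that(1-3)] that(6,7) L
      by (auto simp: less3 orthogonal_family_def numeral_2_eq_2)
  qed
  have one: "orthogonal_family Q 1 (\<lambda>_. L) (\<lambda>_. Q L)" using L by (simp add: orthogonal_family_def)
  obtain w where w: "B w L = 0" "B P w = 1"
    using complement_nondegenerate[OF one P(2)] PL by auto
  define h where "h = w - Q w *s P"
  have h: "Q h = 0" "B P h = 1" "B L h = 0"
    using hyperbolic_partner[OF P(1) w(2)] w(1) PL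
    by (simp_all add: h_def B_simps polar_commute[of Q L])
  have "orthogonal_family Q 3 (?b P' L' h') ?a"
    using fr by (intro fam) (auto simp: frame_def)
  moreover have "orthogonal_family Q 3 (?b P L h) ?a"
    using h P PL by (intro fam) auto
  ultimately obtain f where f: "isometry scale scale Q Q f" "\<forall>i<3. f (?b P' L' h' i) = ?b P L h i"
    using witt by blast
  have add: "f (u + v) = f u + f v" and sc: "f (c *s v) = c *s f v" for u v c
    using f(1) by (auto simp: isometry_def Vector_Spaces.linear_iff)
  have fL: "f L' = L" using f(2)[rule_format, of 0] by simp
  have half: "x = (1/2) *s ((x + y) + (x - y))" for x y using two by (simp add: double)
  have "f P' = (1/2) *s (f (P' + h') + f (P' - h'))"
    by (subst half[of P' h']) (simp only: add sc)
  also have "\<dots> = P"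
    using f(2)[rule_format, of 1] f(2)[rule_format, of 2] half[of P h] by (simp add: numeral_2_eq_2)
  finally have "frame Q P L (f p') (f h')" using frame_isometry_image[OF f(1) fr(1)] fL by simp
  then show ?thesis by blast
qed

text \<open>The cases differ in which vectors Witt's theorem may handle: \<open>P\<close> and
  \<open>L\<close> themselves if both have non-zero norm, a hyperbolic pair in place of the
  isotropic one if only one has. If both are isotropic, \<open>h\<close> and then \<open>p\<close>
  are constructed as hyperbolic partners.\<close>

theorem frame_completion:
  assumes b: "orthogonal_family Q 4 b alternating"
    and PL: "B P L = 0" and nz: "P \<noteq> 0" "L \<noteq> 0" and indep: "\<And>c. P \<noteq> c *s L"
  shows "\<exists>p h. frame Q P L p h"
proof -
  consider "Q P \<noteq> 0" "Q L \<noteq> 0" | "Q P = 0" "Q L \<noteq> 0" | "Q P \<noteq> 0" "Q L = 0" | "Q P = 0" "Q L = 0"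
    by blast
  then show ?thesis
  proof cases
    case 1
    obtain P' L' p' h' where fr: "frame Q P' L' p' h'" "Q P' = Q P" "Q L' = Q L"
      using exists_frame[OF b] by metis
    let ?a = "\<lambda>i. [Q P, Q L] ! i"
    have "orthogonal_family Q 2 (\<lambda>i. [P', L'] ! i) ?a" "orthogonal_family Q 2 (\<lambda>i. [P, L] ! i) ?a"
      using 1 PL fr by (intro orthogonal_family_nth_two; simp add: frame_def)+
    then obtain f where f: "isometry scale scale Q Q f" "\<forall>i<2. f ([P', L'] ! i) = [P, L] ! i"
      using witt by blast
    then have "f P' = P" "f L' = L" using f(2)[rule_format, of 0] f(2)[rule_format, of 1] by auto
    then show ?thesis using frame_isometry_image[OF f(1) fr(1)] by auto
  next
    case 2
    then show ?thesis using frame_completion_isotropic_anisotropic[OF b] PL nz by blast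
  next
    case 3
    then show ?thesis
      using frame_completion_isotropic_anisotropic[OF b, of L P] PL nz frame_swap polar_commute by metis
  next
    case 4
    \<comment> \<open>If the functional \<open>B P\<close> vanished on the kernel of
      \<open>B L\<close>, it would be a multiple of \<open>B L\<close>, and by non-degeneracy
      \<open>P\<close> would be a multiple of \<open>L\<close>.\<close>
    have "\<exists>w. B L w = 0 \<and> B P w \<noteq> 0"
    proof (rule ccontr)
      assume "\<nexists>w. B L w = 0 \<and> B P w \<noteq> 0"
      then have sub: "\<And>w. B L w = 0 \<Longrightarrow> B P w = 0" by blast
      obtain w0 where w0: "B L w0 = 1"
        using complement_nondegenerate[of 0 "\<lambda>_. 0" "\<lambda>_. 0" L] nz(2)
        by (auto simp: orthogonal_family_def)
      have "B (P - B P w0 *s L) v = 0" for v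
        using sub[of "v - B L v *s w0"] w0 by (simp add: B_simps)
      then have "P - B P w0 *s L = 0" by (rule B_nondegenerate)
      then show False using indep by simp
    qed
    then obtain w where w: "B L w = 0" "B P w \<noteq> 0" by blast
    define w1 where "w1 = (1 / B P w) *s w"
    define h where "h = w1 - Q w1 *s P"
    have w1: "B L w1 = 0" "B P w1 = 1" using w by (simp_all add: w1_def B_simps)
    have h: "Q h = 0" "B P h = 1" "B L h = 0"
      using hyperbolic_partner[OF 4(1) w1(2)] w1(1) PL
      by (simp_all add: h_def B_simps polar_commute[of Q L P])
    have fam: "orthogonal_family Q 2 (\<lambda>i. [P + h, P - h] ! i) alternating"
      using hyperbolic_pair_norms[OF 4(1) h(1,2)]
      by (intro orthogonal_family_nth_two) (simp_all add: alternating_def)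
    have "B L ([P + h, P - h] ! i) = 0" if "i < 2" for i
      using that PL h(3) by (auto simp: less_2_cases_iff B_simps polar_commute[of Q L P])
    then obtain w2 where w2: "\<And>i. i < 2 \<Longrightarrow> B w2 ([P + h, P - h] ! i) = 0" "B L w2 = 1"
      using complement_nondegenerate[OF fam nz(2)] by metis
    have sums: "B w2 P + B w2 h = 0" "B w2 P - B w2 h = 0"
      using w2(1)[of 0] w2(1)[of 1] by (simp_all add: B_simps)
    then have "2 * B w2 P = 0" "2 * B w2 h = 0" by (auto simp: algebra_simps)
    then have w2P: "B w2 P = 0" "B w2 h = 0" using two by auto
    define p where "p = w2 - Q w2 *s L"
    have "Q p = 0" "B L p = 1" using hyperbolic_partner[OF 4(2) w2(2)] by (simp_all add: p_def)
    moreover have "B P p = 0" "B p h = 0"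
      using w2P PL h(3) by (simp_all add: p_def B_simps polar_commute[of Q P w2])
    ultimately have "frame Q P L p h" using h PL by (simp add: frame_def)
    then show ?thesis by blast
  qed
qed

end

section \<open>Classification of geometries\<close>

lemma square_class_square_mult: "k \<noteq> 0 \<Longrightarrow> square_class (k\<^sup>2 * a) = square_class a"
  using square_class_eq_iff[of a "k\<^sup>2 * a"] by auto

lemma isometry_image_span:
  assumes "isometry s1 s2 Q Q' f"
  shows "f ` module.span s1 {x} = module.span s2 {f x}"
proof -
  interpret f: Vector_Spaces.linear s1 s2 f using assms by (simp add: isometry_def)
  show ?thesis using f.span_image[of "{x}"] by simp
qed

context form_space
begin

lemma orthogonal_points_span: "orthogonal_points Q (span {u}) (span {v}) \<longleftrightarrow> B u v = 0"
proof
  assume "orthogonal_points Q (span {u}) (span {v})"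
  then show "B u v = 0" unfolding orthogonal_points_def using span_base by blast
next
  assume "B u v = 0"
  then show "orthogonal_points Q (span {u}) (span {v})"
    unfolding orthogonal_points_def span_singleton by (auto simp: B_scale_left B_scale_right)
qed

lemma conformal_geometry_iff:
  "conformal_geometry scale d (Q, P, L) \<longleftrightarrow>
     n = d + 3 \<and> (\<exists>u v. u \<noteq> 0 \<and> v \<noteq> 0 \<and> P = span {u} \<and> L = span {v} \<and> B u v = 0)"
proof -
  have "conformal_geometry scale d (Q, P, L) \<longleftrightarrow>
      n = d + 3 \<and> P \<in> proj_points scale \<and> L \<in> proj_points scale \<and> orthogonal_points Q P L"
    using vector_space_axioms dim_UNIV form by (auto simp: conformal_geometry_def)
  moreover have "X \<in> proj_points scale \<longleftrightarrow> (\<exists>u. u \<noteq> 0 \<and> X = span {u})" for X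
    unfolding proj_points_def by blast
  ultimately show ?thesis using orthogonal_points_span by metis
qed

lemma hypercycle_iff: "hypercycle scale (Q, P, L) c \<longleftrightarrow> (\<exists>v. v \<noteq> 0 \<and> c = span {v} \<and> Q v = 0)"
proof -
  have "(\<forall>x\<in>span {v}. Q x = 0) \<longleftrightarrow> Q v = 0" for v
    using span_base[of v "{v}"] by (auto simp: span_singleton Q_scale)
  then show ?thesis unfolding hypercycle_def proj_points_def by auto
qed

lemma nondegenerate_geometry_iff_frame:
  "nondegenerate_geometry scale d (Q, P, L) \<longleftrightarrow>
     n = d + 3 \<and> (\<exists>u v p h. frame Q u v p h \<and> P = span {u} \<and> L = span {v})"
proof
  assume "nondegenerate_geometry scale d (Q, P, L)"
  then obtain p' h' where conf: "conformal_geometry scale d (Q, P, L)"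
    and p': "is_point scale (Q, P, L) p'" "\<not> is_ideal scale (Q, P, L) p'"
    and h': "is_hyperplane scale (Q, P, L) h'" "\<not> is_ideal scale (Q, P, L) h'"
    and ph: "orthogonal_points Q p' h'"
    unfolding nondegenerate_geometry_def by auto
  obtain u v where uv: "P = span {u}" "L = span {v}" "B u v = 0" and n: "n = d + 3"
    using conf conformal_geometry_iff by auto
  obtain p where p: "p' = span {p}" "Q p = 0"
    using p'(1) hypercycle_iff unfolding is_point_def by auto
  obtain h where h: "h' = span {h}" "Q h = 0"
    using h'(1) hypercycle_iff unfolding is_hyperplane_def by auto
  have B: "B u p = 0" "B v p \<noteq> 0" "B v h = 0" "B u h \<noteq> 0" "B p h = 0"
    using p' h' ph uv p(1) h(1) orthogonal_points_span
    unfolding is_point_def is_hyperplane_def is_ideal_def by auto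
  \<comment> \<open>That \<open>p\<close> and \<open>h\<close> are not ideal means that these two
    pairings are non-zero, and rescaling normalizes them to 1.\<close>
  have "frame Q u v ((1 / B v p) *s p) ((1 / B u h) *s h)"
    using uv p h B by (simp add: frame_def B_simps Q_scale)
  then show "n = d + 3 \<and> (\<exists>u v p h. frame Q u v p h \<and> P = span {u} \<and> L = span {v})"
    using uv n by blast
next
  assume "n = d + 3 \<and> (\<exists>u v p h. frame Q u v p h \<and> P = span {u} \<and> L = span {v})"
  then obtain u v p h where fr: "frame Q u v p h" and uv: "P = span {u}" "L = span {v}" and n: "n = d + 3"
    by blast
  have nz: "u \<noteq> 0" "v \<noteq> 0" "p \<noteq> 0" "h \<noteq> 0"
    using fr by (auto simp: frame_def B_zero)
  have "conformal_geometry scale d (Q, P, L)"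
    using conformal_geometry_iff fr nz uv n unfolding frame_def by blast
  moreover have "hypercycle scale (Q, P, L) (span {p})" "hypercycle scale (Q, P, L) (span {h})"
    using hypercycle_iff fr nz unfolding frame_def by blast+
  moreover have "orthogonal_points Q P (span {p})" "\<not> orthogonal_points Q L (span {p})"
    "orthogonal_points Q L (span {h})" "\<not> orthogonal_points Q P (span {h})"
    "orthogonal_points Q (span {p}) (span {h})"
    using fr by (simp_all add: uv orthogonal_points_span frame_def)
  ultimately show "nondegenerate_geometry scale d (Q, P, L)"
    unfolding nondegenerate_geometry_def is_ideal_def is_point_def is_hyperplane_def
    by (intro conjI exI[of _ "span {p}"] exI[of _ "span {h}"]) simp_all
qed

text \<open>Below the full dimension alternating norms can always be found; in dimension 4 the four
  vectors fill the space, so the form itself must be symplectic.\<close>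

lemma exists_alternating_four_iff:
  "(\<exists>b. orthogonal_family Q 4 b alternating) \<longleftrightarrow> n \<ge> 5 \<or> n = 4 \<and> symplectic scale Q"
proof
  assume "\<exists>b. orthogonal_family Q 4 b alternating"
  then obtain b where b: "orthogonal_family Q 4 b alternating" by blast
  then show "n \<ge> 5 \<or> n = 4 \<and> symplectic scale Q"
    using orthogonal_family_card(2)[OF b] symplectic_iff_alternating by (cases "n = 4") auto
next
  assume "n \<ge> 5 \<or> n = 4 \<and> symplectic scale Q"
  then show "\<exists>b. orthogonal_family Q 4 b alternating"
    using exists_alternating[of 4] symplectic_iff_alternating by auto
qed

theorem nondegenerate_geometry_iff:
  assumes conf: "conformal_geometry scale d (Q, P, L)" and ne: "P \<noteq> L"
  shows "nondegenerate_geometry scale d (Q, P, L) \<longleftrightarrow> n \<ge> 5 \<or> n = 4 \<and> symplectic scale Q"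
  unfolding exists_alternating_four_iff[symmetric]
proof
  assume "nondegenerate_geometry scale d (Q, P, L)"
  then obtain u v p h where "frame Q u v p h" unfolding nondegenerate_geometry_iff_frame by blast
  then show "\<exists>b. orthogonal_family Q 4 b alternating" using frame_family_orthogonal by blast
next
  assume "\<exists>b. orthogonal_family Q 4 b alternating"
  then obtain b where b: "orthogonal_family Q 4 b alternating" by blast
  obtain u v where uv: "u \<noteq> 0" "v \<noteq> 0" "P = span {u}" "L = span {v}" "B u v = 0" and n: "n = d + 3"
    using conf conformal_geometry_iff by auto
  have "u \<noteq> c *s v" for c
  proof
    assume u: "u = c *s v"
    then have "c \<noteq> 0" using uv(1) by auto
    then have "span {u} = span {v}"
      unfolding u using span_image_scale[of "{v}" "\<lambda>_. c"] by simp
    then show False using ne uv by simp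
  qed
  then obtain p h where "frame Q u v p h" using frame_completion[OF b uv(5,1,2)] by blast
  then show "nondegenerate_geometry scale d (Q, P, L)"
    using nondegenerate_geometry_iff_frame uv n by blast
qed

text \<open>If \<open>P\<close> and \<open>L\<close> coincide, every point is also a hyperplane and
  hence ideal.\<close>

lemma nondegenerate_geometry_distinct: "\<not> nondegenerate_geometry scale d (Q, P, P)"
proof
  assume "nondegenerate_geometry scale d (Q, P, P)"
  then obtain u v p h where fr: "frame Q u v p h" and uv: "span {u} = span {v}"
    using nondegenerate_geometry_iff_frame by metis
  have "v \<in> span {u}" using uv span_base by blast
  then obtain c where "v = c *s u" by (auto simp: span_singleton)
  then show False using fr by (auto simp: frame_def B_scale_left)
qed

lemma norm_pair_span:
  assumes "u \<noteq> 0" "v \<noteq> 0"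
  shows "norm_pair (Q, span {u}, span {v}) = (square_class (Q u), square_class (Q v))"
    "c \<noteq> 0 \<Longrightarrow> norm_pair (\<lambda>x. c * Q x, span {u}, span {v}) =
       (square_class (c * Q u), square_class (c * Q v))"
proof -
  have qf: "quadratic_form scale Q" using form by (simp add: nondegenerate_form_def)
  show "norm_pair (Q, span {u}, span {v}) = (square_class (Q u), square_class (Q v))"
    using point_norm_span[OF vector_space_axioms qf] assms by (simp add: norm_pair_def)
  assume "c \<noteq> 0"
  then have "quadratic_form scale (\<lambda>x. c * Q x)"
    using nondegenerate_form_cmult[OF form] by (simp add: nondegenerate_form_def)
  then show "norm_pair (\<lambda>x. c * Q x, span {u}, span {v}) =
       (square_class (c * Q u), square_class (c * Q v))"
    using point_norm_span[OF vector_space_axioms] assms by (simp add: norm_pair_def)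
qed

lemma frame_nonzero: "frame Q u v p h \<Longrightarrow> u \<noteq> 0 \<and> v \<noteq> 0"
  by (auto simp: frame_def B_zero)

lemma nondegenerate_geometryE:
  assumes "nondegenerate_geometry scale d (Q, P, L)"
  obtains u v p h where "frame Q u v p h" "P = span {u}" "L = span {v}"
    "norm_pair (Q, P, L) = (square_class (Q u), square_class (Q v))"
    "\<And>c. c \<noteq> 0 \<Longrightarrow> norm_pair (\<lambda>x. c * Q x, P, L) = (square_class (c * Q u), square_class (c * Q v))"
  using assms nondegenerate_geometry_iff_frame norm_pair_span frame_nonzero by metis

lemma nondegenerate_geometry_cmult:
  assumes "nondegenerate_geometry scale d (Q, P, L)" "c \<noteq> 0"
  shows "nondegenerate_geometry scale d (\<lambda>v. c * Q v, P, L)"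
proof -
  interpret c: form_space scale "\<lambda>v. c * Q v" n by (rule form_space_cmult[OF assms(2)])
  obtain u v p h where fr: "frame Q u v p h" and uv: "P = span {u}" "L = span {v}" and n: "n = d + 3"
    using assms(1) nondegenerate_geometry_iff_frame by auto
  \<comment> \<open>Scaling \<open>Q\<close> scales \<open>B\<close> too, so the partners
    \<open>p\<close> and \<open>h\<close> absorb the inverse factor while \<open>u\<close> and
    \<open>v\<close> stay.\<close>
  have "frame (\<lambda>v. c * Q v) u v ((1 / c) *s p) ((1 / c) *s h)"
    using fr assms(2) by (simp add: frame_def polar_cmult B_simps Q_scale)
  then show ?thesis using c.nondegenerate_geometry_iff_frame uv n by blast
qed

text \<open>Equal norms mean equal values of \<open>Q\<close> up to squares, so suitable multiples
  of the representatives have exactly equal values; the partners are rescaled inversely to keep a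
  frame.\<close>

lemma norm_pair_determines_orbit:
  assumes "nondegenerate_geometry scale d (Q, P, L)" "nondegenerate_geometry scale d (Q, P', L')"
    and norms: "norm_pair (Q, P, L) = norm_pair (Q, P', L')"
  shows "\<exists>f. isometry scale scale Q Q f \<and> f ` P = P' \<and> f ` L = L'"
proof -
  obtain u v p h where fr: "frame Q u v p h" and uv: "P = span {u}" "L = span {v}"
    "norm_pair (Q, P, L) = (square_class (Q u), square_class (Q v))"
    using nondegenerate_geometryE[OF assms(1)] by metis
  obtain u' v' p' h' where fr': "frame Q u' v' p' h'" and uv': "P' = span {u'}" "L' = span {v'}"
    "norm_pair (Q, P', L') = (square_class (Q u'), square_class (Q v'))"
    using nondegenerate_geometryE[OF assms(2)] by metis
  obtain c k where ck: "c \<noteq> 0" "Q u' = c\<^sup>2 * Q u" "k \<noteq> 0" "Q v' = k\<^sup>2 * Q v"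
    using norms uv(3) uv'(3) square_class_eq_iff by (metis prod.inject)
  have "frame Q (c *s u) (k *s v) ((1 / k) *s p) ((1 / c) *s h)"
    using fr ck by (simp add: frame_def B_simps Q_scale)
  then obtain f where f: "isometry scale scale Q Q f" "f (c *s u) = u'" "f (k *s v) = v'"
    using frame_isometry[OF _ fr'] ck Q_scale by metis
  have "span {c *s u} = span {u}" "span {k *s v} = span {v}"
    using span_image_scale[of "{u}" "\<lambda>_. c"] span_image_scale[of "{v}" "\<lambda>_. k"] ck by simp_all
  moreover have "f ` span {x} = span {f x}" for x by (rule isometry_image_span[OF f(1)])
  ultimately show ?thesis using f uv uv' by metis
qed

end

section \<open>Isomorphism of geometries in terms of determinant and norms\<close>

lemma isometry_norm_pair:
  assumes "isometry s1 s2 Q Q' f"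
  shows "norm_pair (Q', f ` P, f ` L) = norm_pair (Q, P, L)"
proof -
  interpret f: Vector_Spaces.linear s1 s2 f using assms by (simp add: isometry_def)
  have inj: "inj f" and Q: "\<And>v. Q' (f v) = Q v" using assms by (auto simp: isometry_def bij_def)
  have "f ` (X - {0}) = f ` X - {0}" for X
    using image_set_diff[OF inj, of X "{0}"] f.zero by simp
  then have "point_norm Q' (f ` X) = point_norm Q X" for X
    unfolding point_norm_def using Q by (metis (no_types, lifting) image_cong image_image)
  then show ?thesis by (simp add: norm_pair_def)
qed

lemma geometry_isomorphic_iff_isometry:
  "geometry_isomorphic s1 s2 (Q, P, L) (Q', P', L') \<longleftrightarrow>
     (\<exists>f c. c \<noteq> 0 \<and> isometry s1 s2 (\<lambda>v. c * Q v) Q' f \<and> f ` P = P' \<and> f ` L = L')"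
  unfolding geometry_isomorphic_def isometry_def by auto

lemma isometry_cmult: "isometry s1 s2 Q Q' f \<Longrightarrow> isometry s1 s2 (\<lambda>v. c * Q v) (\<lambda>v. c * Q' v) f"
  by (simp add: isometry_def)

lemma geometry_isomorphic_refl: "vector_space s \<Longrightarrow> geometry_isomorphic s s G G"
proof -
  assume "vector_space s"
  then have "isometry s s (\<lambda>v. 1 * fst G v) (fst G) id" using isometry_id by simp
  then have "geometry_isomorphic s s (fst G, fst (snd G), snd (snd G)) (fst G, fst (snd G), snd (snd G))"
    unfolding geometry_isomorphic_iff_isometry by (intro exI[of _ id] exI[of _ 1]) simp
  then show ?thesis by simp
qed

lemma geometry_isomorphic_sym:
  assumes "geometry_isomorphic s1 s2 G H"
  shows "geometry_isomorphic s2 s1 H G"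
proof -
  obtain Q P L Q' P' L' where G: "G = (Q, P, L)" "H = (Q', P', L')" by (metis prod_cases3)
  obtain f c where f: "c \<noteq> 0" "isometry s1 s2 (\<lambda>v. c * Q v) Q' f" "f ` P = P'" "f ` L = L'"
    using assms unfolding G geometry_isomorphic_iff_isometry by blast
  have "isometry s2 s1 (\<lambda>v. inverse c * Q' v) (\<lambda>v. inverse c * (c * Q v)) (inv f)"
    by (rule isometry_cmult[OF isometry_inv[OF f(2)]])
  moreover have "(\<lambda>v. inverse c * (c * Q v)) = Q" using f(1) by (auto simp: fun_eq_iff)
  moreover have "inv f ` P' = P" "inv f ` L' = L"
    using f(2,3,4) by (auto simp: isometry_def bij_def image_inv_f_f)
  ultimately show ?thesis unfolding G geometry_isomorphic_iff_isometry
    using f(1) by (intro exI[of _ "inv f"] exI[of _ "inverse c"]) simp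
qed

lemma geometry_isomorphic_trans:
  assumes "geometry_isomorphic s1 s2 G H" "geometry_isomorphic s2 s3 H K"
  shows "geometry_isomorphic s1 s3 G K"
proof -
  obtain Q P L Q' P' L' Q'' P'' L'' where G: "G = (Q, P, L)" "H = (Q', P', L')" "K = (Q'', P'', L'')"
    by (metis prod_cases3)
  obtain f c where f: "c \<noteq> 0" "isometry s1 s2 (\<lambda>v. c * Q v) Q' f" "f ` P = P'" "f ` L = L'"
    using assms(1) unfolding G geometry_isomorphic_iff_isometry by blast
  obtain g k where g: "k \<noteq> 0" "isometry s2 s3 (\<lambda>v. k * Q' v) Q'' g" "g ` P' = P''" "g ` L' = L''"
    using assms(2) unfolding G geometry_isomorphic_iff_isometry by blast
  have "isometry s1 s3 (\<lambda>v. k * (c * Q v)) Q'' (g \<circ> f)"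
    by (rule isometry_compose[OF isometry_cmult[OF f(2)] g(2)])
  then show ?thesis unfolding G geometry_isomorphic_iff_isometry
    using f g by (intro exI[of _ "g \<circ> f"] exI[of _ "k * c"]) (auto simp: mult.assoc image_comp[symmetric])
qed

context form_space_pair
begin

lemma nondegenerate_geometry_isometry_image:
  assumes f: "isometry scaleV scaleW Q Q' f" and G: "nondegenerate_geometry scaleV d (Q, P, L)"
  shows "nondegenerate_geometry scaleW d (Q', f ` P, f ` L)"
proof -
  obtain u v p h where fr: "frame Q u v p h" and uv: "P = V.span {u}" "L = V.span {v}" and n: "n = d + 3"
    using G V.nondegenerate_geometry_iff_frame by auto
  then have "f ` P = W.span {f u}" "f ` L = W.span {f v}"
    using isometry_image_span[OF f] by auto
  then show ?thesis
    using frame_isometry_image[OF f fr] n W.nondegenerate_geometry_iff_frame by blast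
qed

lemma form_space_pair_cmult: "c \<noteq> 0 \<Longrightarrow> form_space_pair scaleV scaleW (\<lambda>v. c * Q v) Q' n"
  using V.form_space_cmult W.form_space_axioms by (simp add: form_space_pair_def)

lemma exists_isomorphic_geometry:
  assumes c: "c \<noteq> 0" and disc: "form_disc n (\<lambda>v. c * Q v) = form_disc n Q'"
    and G: "nondegenerate_geometry scaleV d (Q, P, L)"
  shows "\<exists>P' L'. nondegenerate_geometry scaleW d (Q', P', L') \<and>
                 geometry_isomorphic scaleV scaleW (Q, P, L) (Q', P', L') \<and>
                 norm_pair (Q', P', L') = norm_pair (\<lambda>v. c * Q v, P, L)"
proof -
  interpret c: form_space_pair scaleV scaleW "\<lambda>v. c * Q v" Q' n by (rule form_space_pair_cmult[OF c])
  obtain f where f: "isometry scaleV scaleW (\<lambda>v. c * Q v) Q' f"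
    using c.isometric_iff_disc disc isometric_iff by metis
  have "nondegenerate_geometry scaleW d (Q', f ` P, f ` L)"
    by (rule c.nondegenerate_geometry_isometry_image[OF f V.nondegenerate_geometry_cmult[OF G c]])
  moreover have "geometry_isomorphic scaleV scaleW (Q, P, L) (Q', f ` P, f ` L)"
    unfolding geometry_isomorphic_iff_isometry using f c by blast
  ultimately show ?thesis using isometry_norm_pair[OF f] by blast
qed

text \<open>For the converse, the scaled form is carried onto \<open>Q'\<close> by some isometry,
  which may put \<open>P\<close> and \<open>L\<close> in the wrong place; as their norms are right,
  an isometry of \<open>Q'\<close> onto itself corrects this.\<close>

theorem geometry_isomorphic_iff:
  assumes G: "nondegenerate_geometry scaleV d (Q, P, L)" and H: "nondegenerate_geometry scaleW d (Q', P', L')"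
  shows "geometry_isomorphic scaleV scaleW (Q, P, L) (Q', P', L') \<longleftrightarrow>
     (\<exists>c. c \<noteq> 0 \<and> form_disc n (\<lambda>v. c * Q v) = form_disc n Q' \<and>
          norm_pair (\<lambda>v. c * Q v, P, L) = norm_pair (Q', P', L'))"
proof
  assume "geometry_isomorphic scaleV scaleW (Q, P, L) (Q', P', L')"
  then obtain f c where f: "c \<noteq> 0" "isometry scaleV scaleW (\<lambda>v. c * Q v) Q' f" "f ` P = P'" "f ` L = L'"
    unfolding geometry_isomorphic_iff_isometry by blast
  interpret c: form_space_pair scaleV scaleW "\<lambda>v. c * Q v" Q' n by (rule form_space_pair_cmult[OF f(1)])
  have "form_disc n (\<lambda>v. c * Q v) = form_disc n Q'"
    using c.isometric_iff_disc f(2) isometric_iff by metis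
  then show "\<exists>c. c \<noteq> 0 \<and> form_disc n (\<lambda>v. c * Q v) = form_disc n Q' \<and>
          norm_pair (\<lambda>v. c * Q v, P, L) = norm_pair (Q', P', L')"
    using isometry_norm_pair[OF f(2)] f by metis
next
  assume "\<exists>c. c \<noteq> 0 \<and> form_disc n (\<lambda>v. c * Q v) = form_disc n Q' \<and>
          norm_pair (\<lambda>v. c * Q v, P, L) = norm_pair (Q', P', L')"
  then obtain P'' L'' where PL: "nondegenerate_geometry scaleW d (Q', P'', L'')"
    "geometry_isomorphic scaleV scaleW (Q, P, L) (Q', P'', L'')"
    "norm_pair (Q', P'', L'') = norm_pair (Q', P', L')"
    using exists_isomorphic_geometry[OF _ _ G] by metis
  obtain f where f: "isometry scaleW scaleW Q' Q' f" "f ` P'' = P'" "f ` L'' = L'"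
    using W.norm_pair_determines_orbit[OF PL(1) H PL(3)] by blast
  have "geometry_isomorphic scaleW scaleW (Q', P'', L'') (Q', P', L')"
    unfolding geometry_isomorphic_iff_isometry using f by (intro exI[of _ f] exI[of _ 1]) simp
  then show "geometry_isomorphic scaleV scaleW (Q, P, L) (Q', P', L')"
    using geometry_isomorphic_trans PL(2) by blast
qed

text \<open>Every non-zero scalar is \<open>k^2\<close> or \<open>k^2 * e\<close>. The factor
  \<open>k^2\<close> multiplies the norms by a square and the determinant by the square of
  \<open>k ^ n\<close>, so both invariants ignore it.\<close>

theorem geometry_isomorphic_iff_nonsquare:
  assumes e: "\<nexists>x. e = x\<^sup>2"
    and G: "nondegenerate_geometry scaleV d (Q, P, L)" and H: "nondegenerate_geometry scaleW d (Q', P', L')"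
  shows "geometry_isomorphic scaleV scaleW (Q, P, L) (Q', P', L') \<longleftrightarrow>
     (\<exists>c\<in>{1, e}. form_disc n (\<lambda>v. c * Q v) = form_disc n Q' \<and>
          norm_pair (\<lambda>v. c * Q v, P, L) = norm_pair (Q', P', L'))"
proof -
  have e0: "e \<noteq> 0" using e by (metis zero_power2)
  obtain b a where b: "orthogonal_family Q n b a" using V.exists_orthogonal_basis by blast
  note disc = V.form_disc_cmult[OF _ V.form_disc_eq[OF b]]
  obtain u v p h where uv: "\<And>c. c \<noteq> 0 \<Longrightarrow>
      norm_pair (\<lambda>x. c * Q x, P, L) = (square_class (c * Q u), square_class (c * Q v))"
    using V.nondegenerate_geometryE[OF G] by metis
  have reduce: "form_disc n (\<lambda>v. k\<^sup>2 * t * Q v) = form_disc n (\<lambda>v. t * Q v)"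
    "norm_pair (\<lambda>x. k\<^sup>2 * t * Q x, P, L) = norm_pair (\<lambda>x. t * Q x, P, L)"
    if "k \<noteq> 0" "t \<noteq> 0" for k t
  proof -
    have "(k\<^sup>2 * t) ^ n * x = (k ^ n)\<^sup>2 * (t ^ n * x)" for x
      by (simp add: power_mult_distrib mult.assoc flip: power_mult) (simp add: mult.commute)
    then show "form_disc n (\<lambda>v. k\<^sup>2 * t * Q v) = form_disc n (\<lambda>v. t * Q v)"
      using disc[of "k\<^sup>2 * t"] disc[of t] that square_class_square_mult[of "k ^ n"] by (metis (no_types, lifting) mult_eq_0_iff power_not_zero)
    show "norm_pair (\<lambda>x. k\<^sup>2 * t * Q x, P, L) = norm_pair (\<lambda>x. t * Q x, P, L)"
      using uv[of "k\<^sup>2 * t"] uv[of t] that by (simp add: square_class_square_mult mult.assoc)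
  qed
  have "\<exists>t\<in>{1, e}. form_disc n (\<lambda>v. c * Q v) = form_disc n (\<lambda>v. t * Q v) \<and>
      norm_pair (\<lambda>x. c * Q x, P, L) = norm_pair (\<lambda>x. t * Q x, P, L)" if c: "c \<noteq> 0" for c
  proof -
    obtain k t where k: "k \<noteq> 0" "c = k\<^sup>2 * t" "t \<in> {1, e}"
      using square_or_nonsquare_multiple[OF e c] by auto
    then have "t \<noteq> 0" using c by auto
    then show ?thesis using reduce[OF k(1)] k(2,3) by metis
  qed
  then have "\<exists>t\<in>{1, e}. form_disc n (\<lambda>v. t * Q v) = form_disc n Q' \<and>
      norm_pair (\<lambda>v. t * Q v, P, L) = norm_pair (Q', P', L')"
    if "c \<noteq> 0" "form_disc n (\<lambda>v. c * Q v) = form_disc n Q'"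
      "norm_pair (\<lambda>v. c * Q v, P, L) = norm_pair (Q', P', L')" for c
    using that by metis
  moreover have "c \<noteq> 0" if "c \<in> {1, e}" for c using that e0 by auto
  ultimately show ?thesis unfolding geometry_isomorphic_iff[OF G H] by blast
qed

end

section \<open>Counting\<close>

text \<open>The invariant \<open>F\<close> has to separate classes only on a subset
  \<open>A0\<close> that meets each of them. For odd \<open>n\<close> this allows counting on a
  single fixed form, although isomorphisms may change the form.\<close>

lemma card_quotient_invariant:
  assumes r: "equiv A r" and sub: "A0 \<subseteq> A" and cover: "\<And>x. x \<in> A \<Longrightarrow> \<exists>y\<in>A0. (x, y) \<in> r"
    and inv: "\<And>x y. x \<in> A0 \<Longrightarrow> y \<in> A0 \<Longrightarrow> (x, y) \<in> r \<longleftrightarrow> F x = F y"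
  shows "card (A // r) = card (F ` A0)"
proof -
  have "A // r = (\<lambda>x. r `` {x}) ` A0"
    unfolding quotient_def using cover sub equiv_class_eq[OF r] by (auto simp: image_iff) metis
  moreover have "bij_betw (\<lambda>y. r `` {inv_into A0 F y}) (F ` A0) ((\<lambda>x. r `` {x}) ` A0)"
  proof -
    have eq: "r `` {inv_into A0 F (F x)} = r `` {x}" if "x \<in> A0" for x
      using that inv inv_into_into[of "F x" F A0] f_inv_into_f[of "F x" F A0]
      by (intro equiv_class_eq[OF r]) auto
    have "inj_on (\<lambda>y. r `` {inv_into A0 F y}) (F ` A0)"
    proof (rule inj_onI, clarify)
      fix x y assume xy: "x \<in> A0" "y \<in> A0" "r `` {inv_into A0 F (F x)} = r `` {inv_into A0 F (F y)}"
      then have "(x, y) \<in> r" using eq sub eq_equiv_class[OF _ r] by blast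
      then show "F x = F y" using inv xy by blast
    qed
    then show ?thesis unfolding bij_betw_def using eq by (auto simp: image_image)
  qed
  ultimately show ?thesis using bij_betw_same_card by metis
qed

lemma square_class_representative:
  fixes e x :: "'k::{field,finite}"
  assumes "\<nexists>x. e = x\<^sup>2"
  obtains a where "a \<in> {0, 1, e}" "square_class x = square_class a"
  using assms
proof (cases rule: square_class_cases[where a = x])
  case 1
  then show ?thesis using that[of 0] by simp
next
  case 2
  then show ?thesis using that[of 1] by simp
next
  case 3
  then show ?thesis using that[of e] by simp
qed

text \<open>The orbits of simultaneous multiplication by \<open>e\<close> on pairs of square
  classes, listed without reference to a form.\<close>

definition scaled_norm_pairs :: "'k::field \<Rightarrow> ('k set \<times> 'k set) set set" where
  "scaled_norm_pairs e =
     (\<lambda>(a, b). {(square_class a, square_class b), (square_class (e * a), square_class (e * b))}) `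
       ({0, 1, e} \<times> {0, 1, e})"

text \<open>Multiplication by \<open>e\<close> fixes the pair of zero classes and matches up the
  other eight pairs, so there are 1 + 8/2 orbits.\<close>

lemma card_scaled_norm_pairs:
  fixes e :: "'k::{field,finite}"
  assumes e: "\<nexists>x. e = x\<^sup>2"
  shows "card (scaled_norm_pairs e) = 5"
proof -
  have e0: "e \<noteq> 0" using e by (metis zero_power2)
  have ee: "square_class (e * e) = square_class 1"
    using square_class_self_mult[OF e0, of 1] by simp
  define z o' w where "z = square_class (0::'k)" and "o' = square_class (1::'k)" and "w = square_class e"
  have ne: "z \<noteq> o'" "z \<noteq> w" "o' \<noteq> w" "o' \<noteq> z" "w \<noteq> z" "w \<noteq> o'"
    using square_class_distinct[OF e] by (auto simp: z_def o'_def w_def)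
  have "scaled_norm_pairs e =
      {{(z, z)}, {(z, o'), (z, w)}, {(o', z), (w, z)}, {(o', o'), (w, w)}, {(o', w), (w, o')}}"
    unfolding scaled_norm_pairs_def
    by (simp add: ee insert_Times_insert z_def[symmetric] o'_def[symmetric] w_def[symmetric]
        insert_commute)
  then show ?thesis using ne by (simp add: doubleton_eq_iff)
qed

context form_space
begin

lemma norm_pair_set:
  assumes e: "\<nexists>x. e = x\<^sup>2" and b: "orthogonal_family Q 4 b alternating" and n: "n = d + 3"
  shows "{norm_pair (Q, P, L) | P L. nondegenerate_geometry scale d (Q, P, L)} =
           square_class ` {0, 1, e} \<times> square_class ` {0, 1, e}"
proof (intro equalityI subsetI)
  fix x assume "x \<in> {norm_pair (Q, P, L) | P L. nondegenerate_geometry scale d (Q, P, L)}"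
  then obtain P L where G: "nondegenerate_geometry scale d (Q, P, L)" and x: "x = norm_pair (Q, P, L)"
    by blast
  obtain u v where "x = (square_class (Q u), square_class (Q v))"
    using nondegenerate_geometryE[OF G] x by metis
  moreover have "square_class (Q y) \<in> square_class ` {0, 1, e}" for y
    using square_class_representative[OF e, of "Q y"] by blast
  ultimately show "x \<in> square_class ` {0, 1, e} \<times> square_class ` {0, 1, e}" by blast
next
  fix x assume "x \<in> square_class ` {0, 1, e} \<times> square_class ` {0, 1, e}"
  then obtain \<alpha> \<beta> where x: "x = (square_class \<alpha>, square_class \<beta>)" by blast
  obtain u v p h where fr: "frame Q u v p h" "Q u = \<alpha>" "Q v = \<beta>" using exists_frame[OF b] by metis
  then have "nondegenerate_geometry scale d (Q, span {u}, span {v})"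
    using nondegenerate_geometry_iff_frame n by blast
  moreover have "norm_pair (Q, span {u}, span {v}) = x"
    using norm_pair_span(1) frame_nonzero fr x by metis
  ultimately show "x \<in> {norm_pair (Q, P, L) | P L. nondegenerate_geometry scale d (Q, P, L)}" by blast
qed

lemma norm_pairs_up_to_span:
  assumes "u \<noteq> 0" "v \<noteq> 0" "e \<noteq> 0"
  shows "norm_pairs_up_to e (Q, span {u}, span {v}) =
    {(square_class (Q u), square_class (Q v)), (square_class (e * Q u), square_class (e * Q v))}"
  using norm_pair_span[OF assms(1,2)] assms(3) by (simp add: norm_pairs_up_to_def)

lemma norm_pairs_up_to_set:
  assumes e: "\<nexists>x. e = x\<^sup>2" and b: "orthogonal_family Q 4 b alternating" and n: "n = d + 3"
  shows "{norm_pairs_up_to e (Q, P, L) | P L. nondegenerate_geometry scale d (Q, P, L)} =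
           scaled_norm_pairs e"
proof (intro equalityI subsetI)
  have e0: "e \<noteq> 0" using e by (metis zero_power2)
  fix x assume "x \<in> {norm_pairs_up_to e (Q, P, L) | P L. nondegenerate_geometry scale d (Q, P, L)}"
  then obtain P L where G: "nondegenerate_geometry scale d (Q, P, L)" and x: "x = norm_pairs_up_to e (Q, P, L)"
    by blast
  obtain u v p h where fr: "frame Q u v p h" and PL: "P = span {u}" "L = span {v}"
    using nondegenerate_geometryE[OF G] by metis
  then have x: "x = {(square_class (Q u), square_class (Q v)), (square_class (e * Q u), square_class (e * Q v))}"
    using norm_pairs_up_to_span frame_nonzero e0 x by metis
  obtain \<alpha> where \<alpha>: "\<alpha> \<in> {0, 1, e}" "square_class (Q u) = square_class \<alpha>"
    by (rule square_class_representative[OF e])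
  obtain \<beta> where \<beta>: "\<beta> \<in> {0, 1, e}" "square_class (Q v) = square_class \<beta>"
    by (rule square_class_representative[OF e])
  have "x = {(square_class \<alpha>, square_class \<beta>), (square_class (e * \<alpha>), square_class (e * \<beta>))}"
    unfolding x using \<alpha>(2) \<beta>(2) square_class_mult_cong by metis
  then show "x \<in> scaled_norm_pairs e" using \<alpha>(1) \<beta>(1) unfolding scaled_norm_pairs_def by blast
next
  have e0: "e \<noteq> 0" using e by (metis zero_power2)
  fix x assume "x \<in> scaled_norm_pairs e"
  then obtain \<alpha> \<beta> where
    x: "x = {(square_class \<alpha>, square_class \<beta>), (square_class (e * \<alpha>), square_class (e * \<beta>))}"
    unfolding scaled_norm_pairs_def by blast
  obtain u v p h where fr: "frame Q u v p h" "Q u = \<alpha>" "Q v = \<beta>" using exists_frame[OF b] by metis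
  then have "nondegenerate_geometry scale d (Q, span {u}, span {v})"
    using nondegenerate_geometry_iff_frame n by blast
  moreover have "norm_pairs_up_to e (Q, span {u}, span {v}) = x"
    using norm_pairs_up_to_span frame_nonzero e0 fr x by metis
  ultimately show "x \<in> {norm_pairs_up_to e (Q, P, L) | P L. nondegenerate_geometry scale d (Q, P, L)}"
    by blast
qed

lemma norm_pair_nonsquare_multiple:
  fixes e :: 'k
  assumes e: "\<nexists>x. e = x\<^sup>2" and conf: "conformal_geometry scale d (Q, P, L)"
    and ne: "norm_pair (Q, P, L) \<noteq> (square_class 0, square_class 0)"
  shows "norm_pair (\<lambda>v. e * Q v, P, L) \<noteq> norm_pair (Q, P, L)"
proof
  assume eq: "norm_pair (\<lambda>v. e * Q v, P, L) = norm_pair (Q, P, L)"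
  have e0: "e \<noteq> 0" using e by (metis zero_power2)
  obtain u v where uv: "u \<noteq> 0" "v \<noteq> 0" "P = span {u}" "L = span {v}"
    using conf conformal_geometry_iff by metis
  then have "square_class (e * Q u) = square_class (Q u)" "square_class (e * Q v) = square_class (Q v)"
    using eq norm_pair_span[OF uv(1,2)] e0 by auto
  then have "Q u = 0" "Q v = 0" using square_class_mult_nonsquare[OF e] by blast+
  then show False using ne norm_pair_span(1)[OF uv(1,2)] uv by simp
qed

lemma form_disc_nonsquare_multiple:
  assumes e: "\<nexists>x. e = x\<^sup>2" and "odd n"
  shows "form_disc n (\<lambda>v. e * Q v) \<noteq> form_disc n Q"
proof -
  have e0: "e \<noteq> 0" using e by (metis zero_power2)
  obtain b a where b: "orthogonal_family Q n b a" using exists_orthogonal_basis by blast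
  then have "(\<Prod>i<n. a i) \<noteq> 0" by (auto simp: orthogonal_family_def)
  then show ?thesis
    using form_disc_cmult_odd[OF e0 assms(2) form_disc_eq[OF b]] form_disc_eq[OF b]
      square_class_mult_nonsquare[OF e] by simp
qed

text \<open>The scalar \<open>e\<close> would change the determinant class, so between geometries on
  one form only the scalar 1 remains and the norms are compared as they stand.\<close>

lemma isomorphic_same_form_odd:
  fixes e :: 'k
  assumes e: "\<nexists>x. e = x\<^sup>2" and "odd n"
    and G: "nondegenerate_geometry scale d (Q, P, L)" and H: "nondegenerate_geometry scale d (Q, P', L')"
  shows "geometry_isomorphic scale scale (Q, P, L) (Q, P', L') \<longleftrightarrow>
    norm_pair (Q, P, L) = norm_pair (Q, P', L')"
proof -
  interpret form_space_pair scale scale Q Q n ..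
  show ?thesis unfolding geometry_isomorphic_iff_nonsquare[OF e G H]
    using form_disc_nonsquare_multiple[OF e assms(2)] by simp
qed

end

context form_space_pair
begin

text \<open>There are only two determinant classes, and for odd \<open>n\<close> the factor
  \<open>e\<close> leads from each to the other.\<close>

lemma exists_disc_matching_multiple:
  assumes e: "\<nexists>x. e = x\<^sup>2" and "odd n"
  shows "\<exists>c\<in>{1, e}. form_disc n (\<lambda>v. c * Q v) = form_disc n Q'"
proof -
  have e0: "e \<noteq> 0" using e by (metis zero_power2)
  interpret e: form_space scaleV "\<lambda>v. e * Q v" n by (rule V.form_space_cmult[OF e0])
  show ?thesis
    using V.form_disc_nonsquare_multiple[OF e assms(2)] V.form_disc_cases[OF e]
      e.form_disc_cases[OF e] W.form_disc_cases[OF e] by auto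
qed

text \<open>Scaling leaves the determinant class alone, so the two conditions separate: the
  determinants must agree outright, the norms only up to a common factor \<open>e\<close>.\<close>

lemma isomorphic_iff_even:
  assumes e: "\<nexists>x. e = x\<^sup>2" and "even n"
    and G: "nondegenerate_geometry scaleV d (Q, P, L)" and H: "nondegenerate_geometry scaleW d (Q', P', L')"
  shows "geometry_isomorphic scaleV scaleW (Q, P, L) (Q', P', L') \<longleftrightarrow>
    form_disc n Q = form_disc n Q' \<and> norm_pairs_up_to e (Q, P, L) = norm_pairs_up_to e (Q', P', L')"
proof -
  have e0: "e \<noteq> 0" using e by (metis zero_power2)
  obtain u v p h where G': "norm_pair (Q, P, L) = (square_class (Q u), square_class (Q v))"
    "norm_pair (\<lambda>x. e * Q x, P, L) = (square_class (e * Q u), square_class (e * Q v))"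
    using V.nondegenerate_geometryE[OF G] e0 by metis
  obtain u' v' p' h' where H': "norm_pair (Q', P', L') = (square_class (Q' u'), square_class (Q' v'))"
    "norm_pair (\<lambda>x. e * Q' x, P', L') = (square_class (e * Q' u'), square_class (e * Q' v'))"
    using W.nondegenerate_geometryE[OF H] e0 by metis
  \<comment> \<open>Because multiplication by \<open>e\<close> is a well-defined involution on
    square classes, two of the sets in question are equal as soon as they share a suitable
    member.\<close>
  have one: "square_class (e * x) = square_class (e * y)" if "square_class x = square_class y" for x y
    by (rule square_class_mult_cong[OF that])
  have two: "square_class (e * y) = square_class x" if "square_class (e * x) = square_class y" for x y
    using one[OF that] square_class_self_mult[OF e0, of x] by (simp add: mult.assoc)
  have "norm_pairs_up_to e (Q, P, L) = norm_pairs_up_to e (Q', P', L') \<longleftrightarrow>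
      norm_pair (Q, P, L) = norm_pair (Q', P', L') \<or> norm_pair (\<lambda>x. e * Q x, P, L) = norm_pair (Q', P', L')"
    unfolding norm_pairs_up_to_def G' H' prod.case doubleton_eq_iff prod.inject
    using one two by metis
  then show ?thesis unfolding geometry_isomorphic_iff_nonsquare[OF e G H]
    using V.form_disc_cmult_even[OF e0 assms(2)] by auto
qed

end

section \<open>Counting forms and geometries\<close>

lemma equiv_nondegenerate_geometries:
  assumes "vector_space scale"
  shows "equiv {G. nondegenerate_geometry scale d G}
    {(G, H). nondegenerate_geometry scale d G \<and> nondegenerate_geometry scale d H \<and>
             geometry_isomorphic scale scale G H}"
proof (rule equivI)
  show "sym {(G, H). nondegenerate_geometry scale d G \<and> nondegenerate_geometry scale d H \<and>
             geometry_isomorphic scale scale G H}"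
    using geometry_isomorphic_sym by (intro symI) auto
  show "trans {(G, H). nondegenerate_geometry scale d G \<and> nondegenerate_geometry scale d H \<and>
             geometry_isomorphic scale scale G H}"
    using geometry_isomorphic_trans by (intro transI) (auto simp del: split_paired_All)
qed (use geometry_isomorphic_refl[OF assms] in \<open>auto intro: refl_onI\<close>)

lemma equiv_nondegenerate_forms:
  assumes "vector_space scale"
  shows "equiv {Q. nondegenerate_form scale Q}
    {(Q, Q'). nondegenerate_form scale Q \<and> nondegenerate_form scale Q' \<and> isometric scale scale Q Q'}"
proof (rule equivI)
  show "sym {(Q, Q'). nondegenerate_form scale Q \<and> nondegenerate_form scale Q' \<and> isometric scale scale Q Q'}"
    using isometric_sym by (intro symI) auto
  show "trans {(Q, Q'). nondegenerate_form scale Q \<and> nondegenerate_form scale Q' \<and> isometric scale scale Q Q'}"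
    using isometric_trans by (intro transI) auto
qed (use isometric_refl[OF assms] in \<open>auto intro: refl_onI\<close>)

locale conformal_space = vector_space scale
  for scale :: "'k::{field,finite} \<Rightarrow> 'v::ab_group_add \<Rightarrow> 'v" +
  fixes n :: nat and e :: 'k
  assumes dim_UNIV: "dim UNIV = n" and n_pos: "n \<ge> 1" and two: "(2::'k) \<noteq> 0"
    and nonsquare: "\<nexists>x. e = x\<^sup>2"
begin

lemma form_space: "nondegenerate_form scale Q \<Longrightarrow> form_space scale Q n"
  using vector_space_axioms dim_UNIV n_pos two by (simp add: form_space_def form_space_axioms_def)

lemma nonsquare_nonzero: "e \<noteq> 0" using nonsquare by (metis zero_power2)

lemma exists_form_with_disc:
  assumes "c \<noteq> 0"
  shows "\<exists>Q. nondegenerate_form scale Q \<and> form_disc n Q = square_class c"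
proof -
  obtain m where m: "n = Suc m" using n_pos by (cases n) auto
  have "((\<lambda>_. 1)(m := c)) i \<noteq> 0" for i :: nat using assms by simp
  then obtain Q b where Q: "form_space scale Q n" and b: "orthogonal_family Q n b ((\<lambda>_. 1)(m := c))"
    using exists_form[OF vector_space_axioms dim_UNIV n_pos two, of "(\<lambda>_. 1)(m := c)"] by blast
  have "(\<Prod>i<n. ((\<lambda>_. 1)(m := c)) i) = c" by (simp add: m)
  then show ?thesis using form_space.form_disc_eq[OF Q b] form_space.form[OF Q] by metis
qed

lemma form_disc_image: "form_disc n ` {Q. nondegenerate_form scale Q} = {square_class 1, square_class e}"
proof (intro equalityI subsetI)
  fix x assume "x \<in> form_disc n ` {Q. nondegenerate_form scale Q}"
  then show "x \<in> {square_class 1, square_class e}"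
    using form_space.form_disc_cases[OF form_space nonsquare] by auto
next
  fix x assume "x \<in> {square_class 1, square_class e}"
  then show "x \<in> form_disc n ` {Q. nondegenerate_form scale Q}"
    using exists_form_with_disc[of 1] exists_form_with_disc[OF nonsquare_nonzero] by auto
qed

lemma isometric_iff_disc:
  assumes "nondegenerate_form scale Q" "nondegenerate_form scale Q'"
  shows "isometric scale scale Q Q' \<longleftrightarrow> form_disc n Q = form_disc n Q'"
proof -
  interpret form_space_pair scale scale Q Q' n
    using form_space assms by (simp add: form_space_pair_def)
  show ?thesis by (rule isometric_iff_disc)
qed

lemma card_form_classes: "card (form_classes scale) = 2"
proof -
  have "card (form_classes scale) = card (form_disc n ` {Q. nondegenerate_form scale Q})"
    unfolding form_classes_def
    by (rule card_quotient_invariant[OF equiv_nondegenerate_forms[OF vector_space_axioms]])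
      (auto simp: isometric_iff_disc)
  then show ?thesis unfolding form_disc_image using square_class_distinct[OF nonsquare] by simp
qed

text \<open>Being symplectic depends only on the determinant, hence is constant on classes. Forms of
  determinants \<open>(- 1) ^ m\<close> and \<open>e * (- 1) ^ m\<close> realize both alternatives,
  and two classes are all there are.\<close>

lemma symplectic_form_classes:
  assumes "even n"
  shows "\<exists>C D. form_classes scale = {C, D} \<and> C \<noteq> D \<and>
    (\<forall>Q\<in>C. symplectic scale Q) \<and> (\<forall>Q\<in>D. \<not> symplectic scale Q)"
proof -
  let ?A = "{Q. nondegenerate_form scale Q}"
  let ?r = "{(Q, Q'). nondegenerate_form scale Q \<and> nondegenerate_form scale Q' \<and> isometric scale scale Q Q'}"
  obtain m where m: "n = 2 * m" using assms by blast
  let ?s = "square_class ((- 1) ^ m) :: 'k set"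
  note eqv = equiv_nondegenerate_forms[OF vector_space_axioms]
  have symp: "symplectic scale Q \<longleftrightarrow> form_disc n Q = ?s" if "nondegenerate_form scale Q" for Q
    by (rule form_space.symplectic_iff_disc[OF form_space[OF that] m])
  have const: "symplectic scale Q \<longleftrightarrow> symplectic scale Q'" if "(Q, Q') \<in> ?r" for Q Q'
    using that symp isometric_iff_disc by auto
  have ms: "(- 1) ^ m \<noteq> (0::'k)" by simp
  have es: "e * (- 1) ^ m \<noteq> 0" using nonsquare_nonzero by simp
  obtain Q1 where Q1: "nondegenerate_form scale Q1" "form_disc n Q1 = ?s"
    using exists_form_with_disc[OF ms] by blast
  obtain Q2 where Q2: "nondegenerate_form scale Q2" "form_disc n Q2 = square_class (e * (- 1) ^ m)"
    using exists_form_with_disc[OF es] by blast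
  have "form_disc n Q2 \<noteq> ?s" using Q2(2) square_class_mult_nonsquare[OF nonsquare ms] by simp
  then have sQ: "symplectic scale Q1" "\<not> symplectic scale Q2" using symp Q1 Q2(1) by auto
  let ?C = "?r `` {Q1}" and ?D = "?r `` {Q2}"
  have C: "\<forall>Q\<in>?C. symplectic scale Q" and D: "\<forall>Q\<in>?D. \<not> symplectic scale Q"
    using const sQ by blast+
  have "Q1 \<in> ?C" using equiv_class_self[OF eqv] Q1(1) by simp
  then have ne: "?C \<noteq> ?D" using C D by blast
  have "?C \<in> form_classes scale" "?D \<in> form_classes scale"
    unfolding form_classes_def using Q1(1) Q2(1) by (simp_all only: quotientI mem_Collect_eq)
  then have "{?C, ?D} \<subseteq> form_classes scale" by blast
  moreover have "finite (form_classes scale)" using card_form_classes by (intro card_ge_0_finite) simp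
  ultimately have "{?C, ?D} = form_classes scale"
    using card_form_classes ne by (intro card_subset_eq) auto
  then show ?thesis using C D ne by (intro exI[of _ ?C] exI[of _ ?D]) auto
qed

text \<open>Scaling by 1 or \<open>e\<close> brings every geometry onto one fixed form; there the
  pair of norms is a complete invariant and takes all 3 * 3 values.\<close>

lemma card_nondegenerate_classes_odd:
  assumes n: "n = d + 3" "odd n" "n \<ge> 5"
  shows "card (nondegenerate_geometry_classes scale d) = 9"
proof -
  obtain Q where Q: "nondegenerate_form scale Q" using exists_form_with_disc[of 1] by auto
  interpret Q: form_space scale Q n by (rule form_space[OF Q])
  obtain b where b: "orthogonal_family Q 4 b alternating" using Q.exists_alternating_four_iff n(3) by blast
  let ?A0 = "{(Q, P, L) | P L. nondegenerate_geometry scale d (Q, P, L)}"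
  have "card (nondegenerate_geometry_classes scale d) = card (norm_pair ` ?A0)"
    unfolding nondegenerate_geometry_classes_def
  proof (rule card_quotient_invariant[OF equiv_nondegenerate_geometries[OF vector_space_axioms]])
    fix G assume "G \<in> {G. nondegenerate_geometry scale d G}"
    moreover obtain Q' P L where G: "G = (Q', P, L)" by (metis prod_cases3)
    ultimately have nd: "nondegenerate_geometry scale d (Q', P, L)" by simp
    then have "nondegenerate_form scale Q'"
      by (simp add: nondegenerate_geometry_def conformal_geometry_def)
    then interpret pair: form_space_pair scale scale Q' Q n
      using form_space Q by (simp add: form_space_pair_def)
    obtain c where c: "c \<in> {1, e}" "form_disc n (\<lambda>v. c * Q' v) = form_disc n Q"
      using pair.exists_disc_matching_multiple[OF nonsquare n(2)] by blast
    have "c \<noteq> 0" using c(1) nonsquare_nonzero by auto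
    then obtain P' L' where "nondegenerate_geometry scale d (Q, P', L')"
        "geometry_isomorphic scale scale (Q', P, L) (Q, P', L')"
      using pair.exists_isomorphic_geometry[OF _ c(2) nd] by blast
    then show "\<exists>H\<in>?A0. (G, H) \<in> {(G, H). nondegenerate_geometry scale d G \<and>
        nondegenerate_geometry scale d H \<and> geometry_isomorphic scale scale G H}"
      using nd unfolding G by auto
  qed (auto simp: Q.isomorphic_same_form_odd[OF nonsquare n(2)])
  also have "norm_pair ` ?A0 = {norm_pair (Q, P, L) | P L. nondegenerate_geometry scale d (Q, P, L)}"
    by blast
  also have "\<dots> = square_class ` {0, 1, e} \<times> square_class ` {0, 1, e}"
    by (rule Q.norm_pair_set[OF nonsquare b n(1)])
  also have "card (square_class ` {0, 1, e}) = 3" using square_class_distinct[OF nonsquare]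
    by (auto simp: card_insert_if)
  then have "card (square_class ` {0, 1, e} \<times> square_class ` {0, 1, e}) = 9"
    by (simp only: card_cartesian_product)
  finally show ?thesis .
qed

text \<open>\<open>D\<close> collects the determinants of those forms that carry a frame. Each such
  form admits all norms of \<open>P\<close> and \<open>L\<close>, so determinant and scaled norm
  pair vary independently and the count is a product.\<close>

lemma card_nondegenerate_classes_even:
  assumes n: "n = d + 3" "even n"
  defines "D \<equiv> form_disc n ` {Q. nondegenerate_form scale Q \<and> (n \<ge> 5 \<or> n = 4 \<and> symplectic scale Q)}"
  shows "card (nondegenerate_geometry_classes scale d) = card D * 5"
proof -
  let ?F = "\<lambda>G :: ('k, 'v) geometry. (form_disc n (fst G), norm_pairs_up_to e G)"
  have nf: "nondegenerate_form scale Q" if "nondegenerate_geometry scale d (Q, P, L)" for Q P L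
    using that by (simp add: nondegenerate_geometry_def conformal_geometry_def)
  have inv: "geometry_isomorphic scale scale G H \<longleftrightarrow> ?F G = ?F H"
    if GH: "nondegenerate_geometry scale d G" "nondegenerate_geometry scale d H" for G H
  proof -
    obtain Q P L Q' P' L' where G: "G = (Q, P, L)" "H = (Q', P', L')" by (metis prod_cases3)
    interpret pair: form_space_pair scale scale Q Q' n
      using form_space nf GH unfolding G by (metis form_space_pair_def)
    show ?thesis using pair.isomorphic_iff_even[OF nonsquare n(2)] GH unfolding G by simp
  qed
  have "card (nondegenerate_geometry_classes scale d) = card (?F ` {G. nondegenerate_geometry scale d G})"
    unfolding nondegenerate_geometry_classes_def
  proof (rule card_quotient_invariant[OF equiv_nondegenerate_geometries[OF vector_space_axioms]])
    fix G :: "('k, 'v) geometry" assume "G \<in> {G. nondegenerate_geometry scale d G}"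
    then show "\<exists>H\<in>{G. nondegenerate_geometry scale d G}. (G, H) \<in>
        {(G, H). nondegenerate_geometry scale d G \<and> nondegenerate_geometry scale d H \<and>
                 geometry_isomorphic scale scale G H}"
      using geometry_isomorphic_refl[OF vector_space_axioms] by blast
  next
    fix G H :: "('k, 'v) geometry"
    assume "G \<in> {G. nondegenerate_geometry scale d G}" "H \<in> {G. nondegenerate_geometry scale d G}"
    then show "(G, H) \<in> {(G, H). nondegenerate_geometry scale d G \<and> nondegenerate_geometry scale d H \<and>
                 geometry_isomorphic scale scale G H} \<longleftrightarrow> ?F G = ?F H"
      using inv by blast
  qed simp
  also have "?F ` {G. nondegenerate_geometry scale d G} = D \<times> scaled_norm_pairs e"
  proof (intro equalityI subsetI)
    fix x assume "x \<in> ?F ` {G. nondegenerate_geometry scale d G}"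
    then obtain Q P L where G: "nondegenerate_geometry scale d (Q, P, L)" and x: "x = ?F (Q, P, L)"
      by (metis (no_types, lifting) imageE mem_Collect_eq prod_cases3)
    interpret Q: form_space scale Q n using form_space nf G by blast
    obtain u v p h where "frame Q u v p h" using Q.nondegenerate_geometryE[OF G] by metis
    then have b: "orthogonal_family Q 4 (Q.frame_family u v p h) alternating"
      by (rule Q.frame_family_orthogonal)
    then have "n \<ge> 5 \<or> n = 4 \<and> symplectic scale Q" using Q.exists_alternating_four_iff by blast
    then have "form_disc n Q \<in> D" unfolding D_def using Q.form by blast
    moreover have "norm_pairs_up_to e (Q, P, L) \<in> scaled_norm_pairs e"
      using Q.norm_pairs_up_to_set[OF nonsquare b n(1)] G by blast
    ultimately show "x \<in> D \<times> scaled_norm_pairs e" using x by simp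
  next
    fix x assume "x \<in> D \<times> scaled_norm_pairs e"
    then obtain Q N where x: "x = (form_disc n Q, N)" "N \<in> scaled_norm_pairs e"
      and Q: "nondegenerate_form scale Q" "n \<ge> 5 \<or> n = 4 \<and> symplectic scale Q"
      unfolding D_def by auto
    interpret Q: form_space scale Q n using form_space Q(1) by blast
    obtain b where b: "orthogonal_family Q 4 b alternating"
      using Q.exists_alternating_four_iff Q(2) by blast
    have "N \<in> {norm_pairs_up_to e (Q, P, L) | P L. nondegenerate_geometry scale d (Q, P, L)}"
      using x(2) Q.norm_pairs_up_to_set[OF nonsquare b n(1)] by simp
    then obtain P L where "N = norm_pairs_up_to e (Q, P, L)" "nondegenerate_geometry scale d (Q, P, L)"
      by blast
    then show "x \<in> ?F ` {G. nondegenerate_geometry scale d G}"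
      unfolding x(1) by (intro image_eqI[of _ _ "(Q, P, L)"]) simp_all
  qed
  finally show ?thesis by (simp add: card_cartesian_product card_scaled_norm_pairs[OF nonsquare])
qed

lemma card_nondegenerate_classes_even_large:
  assumes "n = d + 3" "even n" "n > 5"
  shows "card (nondegenerate_geometry_classes scale d) = 10"
proof -
  have "card (form_disc n ` {Q. nondegenerate_form scale Q}) = 2"
    unfolding form_disc_image using square_class_distinct[OF nonsquare] by simp
  then show ?thesis using card_nondegenerate_classes_even[OF assms(1,2)] assms(3) by simp
qed

text \<open>For \<open>n = 4\<close> the symplectic determinant is \<open>(- 1) ^ 2 = 1\<close>,
  which leaves a single class in the first factor of the product.\<close>

lemma card_nondegenerate_classes_four:
  assumes n: "n = d + 3" "n = 4"
  shows "card (nondegenerate_geometry_classes scale d) = 5"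
proof -
  have symp: "symplectic scale Q \<longleftrightarrow> form_disc n Q = square_class 1" if "nondegenerate_form scale Q" for Q
    using form_space.symplectic_iff_disc[OF form_space[OF that], of 2] n(2) by simp
  obtain Q where "nondegenerate_form scale Q" "form_disc n Q = square_class 1"
    using exists_form_with_disc[of 1] by auto
  then have "form_disc n ` {Q. nondegenerate_form scale Q \<and> (n \<ge> 5 \<or> n = 4 \<and> symplectic scale Q)} =
      {square_class 1}"
    using n(2) symp by auto
  then show ?thesis using card_nondegenerate_classes_even[OF n(1)] n(2) by simp
qed

end

text \<open>The second space \<open>scaleW\<close> of the same dimension shows that nothing depends
  on the choice of the underlying space: each geometry on it is isomorphic to one on
  \<open>scaleV\<close>, where the classes are counted. The case \<open>P = L\<close> is separated
  because such a geometry is degenerate in every dimension. As \<open>n = d + 3\<close>, the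
  parities of \<open>d\<close> and \<open>n\<close> are opposite.\<close>

theorem mainTheorem5:
  fixes scaleV :: "'k::{field,finite} \<Rightarrow> 'v::ab_group_add \<Rightarrow> 'v"
    and scaleW :: "'k \<Rightarrow> 'w::ab_group_add \<Rightarrow> 'w"
    and e :: 'k and n :: nat
  assumes char: "CHAR('k) \<noteq> 2"
    and nonsquare: "\<nexists>x. e = x\<^sup>2"
    and n: "n \<ge> 1"
    and V: "vector_space scaleV" "vector_space.dim scaleV UNIV = n"
    and W: "vector_space scaleW" "vector_space.dim scaleW UNIV = n"
  shows
    "(\<forall>Q. nondegenerate_form scaleV Q \<longrightarrow> (\<exists>b a. diagonal_in scaleV n Q b a)) \<and>
     (\<forall>Q Q' b b' a a'.
        nondegenerate_form scaleV Q \<and> diagonal_in scaleV n Q b a \<and>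
        nondegenerate_form scaleW Q' \<and> diagonal_in scaleW n Q' b' a' \<longrightarrow>
        (isometric scaleV scaleW Q Q' \<longleftrightarrow>
         square_class (\<Prod>i<n. a i) = square_class (\<Prod>i<n. a' i))) \<and>
     card (form_classes scaleV) = 2 \<and>
     (\<forall>Q U. nondegenerate_form scaleV Q \<and> maximal_symplectic_subspace scaleV Q U \<longrightarrow>
        vector_space.dim scaleV U \<ge> (if even (n - 1) then n - 1 else n - 2)) \<and>
     (\<forall>d. n = d + 3 \<longrightarrow>
        (\<forall>Q P L. conformal_geometry scaleV d (Q, P, L) \<longrightarrow>
           (P \<noteq> L \<longrightarrow>
              (nondegenerate_geometry scaleV d (Q, P, L) \<longleftrightarrow>
               n \<ge> 5 \<or> n = 4 \<and> symplectic scaleV Q)) \<and>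
           (P = L \<longrightarrow> \<not> nondegenerate_geometry scaleV d (Q, P, L))) \<and>
        (\<forall>G. nondegenerate_geometry scaleW d G \<longrightarrow>
           (\<exists>H. nondegenerate_geometry scaleV d H \<and> geometry_isomorphic scaleW scaleV G H)) \<and>
        (even d \<longrightarrow>
           (\<forall>Q Q'. nondegenerate_form scaleV Q \<and> nondegenerate_form scaleW Q' \<and>
              \<not> isometric scaleV scaleW Q Q' \<longrightarrow>
              isometric scaleV scaleW (\<lambda>v. e * Q v) Q') \<and>
           (n \<ge> 5 \<longrightarrow>
              (\<forall>Q. nondegenerate_form scaleV Q \<longrightarrow>
                 (\<forall>G. nondegenerate_geometry scaleW d G \<longrightarrow>
                    (\<exists>P L. nondegenerate_geometry scaleV d (Q, P, L) \<and>
                           geometry_isomorphic scaleW scaleV G (Q, P, L))) \<and>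
                 (\<forall>P L P' L'.
                    nondegenerate_geometry scaleV d (Q, P, L) \<and>
                    nondegenerate_geometry scaleV d (Q, P', L') \<longrightarrow>
                    (geometry_isomorphic scaleV scaleV (Q, P, L) (Q, P', L') \<longleftrightarrow>
                     norm_pair (Q, P, L) = norm_pair (Q, P', L'))) \<and>
                 {norm_pair (Q, P, L) | P L. nondegenerate_geometry scaleV d (Q, P, L)} =
                   square_class ` {0, 1, e} \<times> square_class ` {0, 1, e}) \<and>
              card (nondegenerate_geometry_classes scaleV d) = 9)) \<and>
        (odd d \<longrightarrow>
           (\<forall>Q Q'. nondegenerate_form scaleV Q \<and> nondegenerate_form scaleW Q' \<and>
              \<not> isometric scaleV scaleW Q Q' \<longrightarrow>
              (\<forall>c. c \<noteq> 0 \<longrightarrow> \<not> isometric scaleV scaleW (\<lambda>v. c * Q v) Q')) \<and>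
           (\<forall>Q. nondegenerate_form scaleV Q \<longrightarrow> isometric scaleV scaleV (\<lambda>v. e * Q v) Q) \<and>
           (\<exists>C D. form_classes scaleV = {C, D} \<and> C \<noteq> D \<and>
              (\<forall>Q\<in>C. symplectic scaleV Q) \<and> (\<forall>Q\<in>D. \<not> symplectic scaleV Q)) \<and>
           (\<forall>Q. nondegenerate_form scaleV Q \<longrightarrow>
              (n = 4 \<longrightarrow>
                 ((\<exists>P L. nondegenerate_geometry scaleV d (Q, P, L)) \<longleftrightarrow> symplectic scaleV Q)) \<and>
              (n \<ge> 5 \<longrightarrow> (\<exists>P L. nondegenerate_geometry scaleV d (Q, P, L)))) \<and>
           (\<forall>Q P L. conformal_geometry scaleV d (Q, P, L) \<and>
              norm_pair (Q, P, L) \<noteq> (square_class 0, square_class 0) \<longrightarrow>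
              norm_pair (\<lambda>v. e * Q v, P, L) \<noteq> norm_pair (Q, P, L)) \<and>
           (\<forall>Q. nondegenerate_form scaleV Q \<and> (n = 4 \<longrightarrow> symplectic scaleV Q) \<longrightarrow>
              (\<forall>P L P' L'.
                 nondegenerate_geometry scaleV d (Q, P, L) \<and>
                 nondegenerate_geometry scaleV d (Q, P', L') \<longrightarrow>
                 (geometry_isomorphic scaleV scaleV (Q, P, L) (Q, P', L') \<longleftrightarrow>
                  norm_pairs_up_to e (Q, P, L) = norm_pairs_up_to e (Q, P', L'))) \<and>
              card {norm_pairs_up_to e (Q, P, L) | P L.
                      nondegenerate_geometry scaleV d (Q, P, L)} = 5) \<and>
           (n > 5 \<longrightarrow> card (nondegenerate_geometry_classes scaleV d) = 10) \<and>
           (n = 4 \<longrightarrow> card (nondegenerate_geometry_classes scaleV d) = 5)))"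
proof -
  have two: "(2::'k) \<noteq> 0"
  proof
    assume "(2::'k) = 0"
    then have "CHAR('k) dvd 2" using of_nat_eq_0_iff_char_dvd[of 2, where 'a='k] by simp
    moreover from this have "CHAR('k) \<le> 2" "CHAR('k) \<noteq> 0"
      by (simp_all add: dvd_imp_le) (metis dvd_0_left_iff gr0I zero_neq_numeral)
    moreover have "CHAR('k) \<noteq> 1" using of_nat_CHAR[where 'a='k] by auto
    ultimately show False using char by linarith
  qed
  have e0: "e \<noteq> 0" using nonsquare by (metis zero_power2)
  interpret V: conformal_space scaleV n e
    using V n two nonsquare by (simp add: conformal_space_def conformal_space_axioms_def)
  interpret W: conformal_space scaleW n e
    using W n two nonsquare by (simp add: conformal_space_def conformal_space_axioms_def)
  have VW: "form_space_pair scaleV scaleW Q Q' n"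
    if "nondegenerate_form scaleV Q" "nondegenerate_form scaleW Q'" for Q Q'
    using V.form_space W.form_space that by (simp add: form_space_pair_def)
  have WV: "form_space_pair scaleW scaleV Q Q' n"
    if "nondegenerate_form scaleW Q" "nondegenerate_form scaleV Q'" for Q Q'
    using V.form_space W.form_space that by (simp add: form_space_pair_def)
  have form_V: "nondegenerate_form scaleV Q" if "conformal_geometry scaleV d (Q, P, L)" for d Q P L
    using that by (simp add: conformal_geometry_def)
  have form_W: "nondegenerate_form scaleW Q" if "nondegenerate_geometry scaleW d (Q, P, L)" for d Q P L
    using that by (simp add: conformal_geometry_def nondegenerate_geometry_def)

  have diagonal: "\<exists>b a. diagonal_in scaleV n Q b a" if Q: "nondegenerate_form scaleV Q" for Q
    using form_space.exists_orthogonal_basis[OF V.form_space[OF Q]]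
      form_space.diagonal_iff_orthogonal_family[OF V.form_space[OF Q]] by blast

  have classification: "isometric scaleV scaleW Q Q' \<longleftrightarrow>
      square_class (\<Prod>i<n. a i) = square_class (\<Prod>i<n. a' i)"
    if Q: "nondegenerate_form scaleV Q" "diagonal_in scaleV n Q b a"
      and Q': "nondegenerate_form scaleW Q'" "diagonal_in scaleW n Q' b' a'" for Q Q' b b' a a'
  proof -
    interpret form_space_pair scaleV scaleW Q Q' n by (rule VW[OF Q(1) Q'(1)])
    show ?thesis
      using isometric_iff_disc V.form_disc_eq W.form_disc_eq Q(2) Q'(2)
        V.diagonal_iff_orthogonal_family W.diagonal_iff_orthogonal_family by metis
  qed

  have nondegenerate: "(P \<noteq> L \<longrightarrow>
              (nondegenerate_geometry scaleV d (Q, P, L) \<longleftrightarrow>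
               n \<ge> 5 \<or> n = 4 \<and> symplectic scaleV Q)) \<and>
           (P = L \<longrightarrow> \<not> nondegenerate_geometry scaleV d (Q, P, L))"
    if conf: "conformal_geometry scaleV d (Q, P, L)" for d Q P L
  proof -
    interpret form_space scaleV Q n by (rule V.form_space[OF form_V[OF conf]])
    show ?thesis using nondegenerate_geometry_iff[OF conf] nondegenerate_geometry_distinct by blast
  qed

  have transport: "\<exists>H. nondegenerate_geometry scaleV d H \<and> geometry_isomorphic scaleW scaleV G H"
    if G: "nondegenerate_geometry scaleW d G" for d G
  proof -
    obtain Q P L where G': "G = (Q, P, L)" by (metis prod_cases3)
    then have Q: "nondegenerate_form scaleW Q" using form_W G by blast
    interpret Q: form_space scaleW Q n by (rule W.form_space[OF Q])
    \<comment> \<open>A form of the same determinant is built on the other space, so that the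
      geometry can be carried over with scalar 1.\<close>
    obtain c where "c \<noteq> 0" "form_disc n Q = square_class c"
      using Q.form_disc_cases[OF nonsquare] e0 zero_neq_one by metis
    then obtain Q' where Q': "nondegenerate_form scaleV Q'" "form_disc n Q' = form_disc n Q"
      using V.exists_form_with_disc by metis
    interpret form_space_pair scaleW scaleV Q Q' n by (rule WV[OF Q Q'(1)])
    show ?thesis
      using exists_isomorphic_geometry[of 1] Q'(2) G unfolding G' by force
  qed

  have odd_isometric: "isometric scaleV scaleW (\<lambda>v. e * Q v) Q'"
    if "odd n" and Q: "nondegenerate_form scaleV Q" "nondegenerate_form scaleW Q'"
      and ni: "\<not> isometric scaleV scaleW Q Q'" for Q Q'
  proof -
    interpret form_space_pair scaleV scaleW Q Q' n by (rule VW[OF Q])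
    interpret e: form_space_pair scaleV scaleW "\<lambda>v. e * Q v" Q' n by (rule form_space_pair_cmult[OF e0])
    show ?thesis
      using exists_disc_matching_multiple[OF nonsquare \<open>odd n\<close>] ni isometric_iff_disc e.isometric_iff_disc
      by auto
  qed

  have odd_transport: "\<exists>P L. nondegenerate_geometry scaleV d (Q, P, L) \<and>
                           geometry_isomorphic scaleW scaleV G (Q, P, L)"
    if "odd n" and Q: "nondegenerate_form scaleV Q" and G: "nondegenerate_geometry scaleW d G" for d Q G
  proof -
    obtain Q' P L where G': "G = (Q', P, L)" by (metis prod_cases3)
    then have Q': "nondegenerate_form scaleW Q'" using form_W G by blast
    interpret form_space_pair scaleW scaleV Q' Q n by (rule WV[OF Q' Q])
    obtain c where c: "c \<in> {1, e}" "form_disc n (\<lambda>v. c * Q' v) = form_disc n Q"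
      using exists_disc_matching_multiple[OF nonsquare \<open>odd n\<close>] by blast
    have "c \<noteq> 0" using c(1) e0 by auto
    then show ?thesis using exists_isomorphic_geometry[OF _ c(2)] G unfolding G' by blast
  qed

  have odd_isomorphic: "geometry_isomorphic scaleV scaleV (Q, P, L) (Q, P', L') \<longleftrightarrow>
      norm_pair (Q, P, L) = norm_pair (Q, P', L')"
    if "odd n" and Q: "nondegenerate_form scaleV Q"
      and G: "nondegenerate_geometry scaleV d (Q, P, L) \<and> nondegenerate_geometry scaleV d (Q, P', L')"
    for d Q P L P' L'
    using form_space.isomorphic_same_form_odd[OF V.form_space[OF Q] nonsquare \<open>odd n\<close>] G by blast

  have split: "\<exists>b. orthogonal_family Q 4 b alternating"
    if "nondegenerate_form scaleV Q" "n \<ge> 5 \<or> n = 4 \<and> symplectic scaleV Q" for Q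
    using form_space.exists_alternating_four_iff[OF V.form_space[OF that(1)]] that(2) by blast

  have odd_norms: "{norm_pair (Q, P, L) | P L. nondegenerate_geometry scaleV d (Q, P, L)} =
      square_class ` {0, 1, e} \<times> square_class ` {0, 1, e}"
    if Q: "nondegenerate_form scaleV Q" and "n \<ge> 5" "n = d + 3" for d Q
    using form_space.norm_pair_set[OF V.form_space[OF Q] nonsquare] split[OF Q] that by blast

  have even_not_isometric: "\<not> isometric scaleV scaleW (\<lambda>v. c * Q v) Q'"
    if "even n" and Q: "nondegenerate_form scaleV Q" "nondegenerate_form scaleW Q'"
      and ni: "\<not> isometric scaleV scaleW Q Q'" and c: "c \<noteq> 0" for Q Q' c
  proof -
    interpret form_space_pair scaleV scaleW Q Q' n by (rule VW[OF Q])
    interpret c: form_space_pair scaleV scaleW "\<lambda>v. c * Q v" Q' n by (rule form_space_pair_cmult[OF c])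
    show ?thesis
      using isometric_iff_disc c.isometric_iff_disc ni V.form_disc_cmult_even[OF c \<open>even n\<close>] by simp
  qed

  have even_isometric: "isometric scaleV scaleV (\<lambda>v. e * Q v) Q"
    if "even n" and Q: "nondegenerate_form scaleV Q" for Q
    using V.isometric_iff_disc[OF nondegenerate_form_cmult[OF Q e0] Q]
      form_space.form_disc_cmult_even[OF V.form_space[OF Q] e0 \<open>even n\<close>] by simp

  have exists_nondegenerate: "\<exists>P L. nondegenerate_geometry scaleV d (Q, P, L)"
    if Q: "nondegenerate_form scaleV Q" and "n \<ge> 5 \<or> n = 4 \<and> symplectic scaleV Q" "n = d + 3" for d Q
    using form_space.norm_pair_set[OF V.form_space[OF Q] nonsquare] split[OF Q] that by blast

  have exists_four: "(\<exists>P L. nondegenerate_geometry scaleV d (Q, P, L)) \<longleftrightarrow> symplectic scaleV Q"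
    if Q: "nondegenerate_form scaleV Q" and four: "n = 4" "n = d + 3" for d Q
  proof
    assume "\<exists>P L. nondegenerate_geometry scaleV d (Q, P, L)"
    then obtain P L where G: "nondegenerate_geometry scaleV d (Q, P, L)" by blast
    then have "conformal_geometry scaleV d (Q, P, L)" by (simp add: nondegenerate_geometry_def)
    then show "symplectic scaleV Q" using nondegenerate G four(1) by force
  qed (use exists_nondegenerate[OF Q] four in blast)

  have norms_multiple: "norm_pair (\<lambda>v. e * Q v, P, L) \<noteq> norm_pair (Q, P, L)"
    if "conformal_geometry scaleV d (Q, P, L) \<and> norm_pair (Q, P, L) \<noteq> (square_class 0, square_class 0)"
    for d Q P L
    using form_space.norm_pair_nonsquare_multiple[OF V.form_space[OF form_V] nonsquare] that by blast

  have even_isomorphic: "geometry_isomorphic scaleV scaleV (Q, P, L) (Q, P', L') \<longleftrightarrow>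
      norm_pairs_up_to e (Q, P, L) = norm_pairs_up_to e (Q, P', L')"
    if "even n" and Q: "nondegenerate_form scaleV Q"
      and G: "nondegenerate_geometry scaleV d (Q, P, L) \<and> nondegenerate_geometry scaleV d (Q, P', L')"
    for d Q P L P' L'
  proof -
    interpret form_space_pair scaleV scaleV Q Q n
      using V.form_space Q by (simp add: form_space_pair_def)
    show ?thesis using isomorphic_iff_even[OF nonsquare \<open>even n\<close>] G by blast
  qed

  have even_norms: "card {norm_pairs_up_to e (Q, P, L) | P L. nondegenerate_geometry scaleV d (Q, P, L)} = 5"
    if Q: "nondegenerate_form scaleV Q" and sp: "n \<ge> 5 \<or> n = 4 \<and> symplectic scaleV Q" and n: "n = d + 3" for d Q
  proof -
    obtain b where "orthogonal_family Q 4 b alternating" using split[OF Q sp] by blast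
    then show ?thesis
      using form_space.norm_pairs_up_to_set[OF V.form_space[OF Q] nonsquare _ n]
        card_scaled_norm_pairs[OF nonsquare] by simp
  qed

  have maximal: "V.dim U \<ge> (if even (n - 1) then n - 1 else n - 2)"
    if "nondegenerate_form scaleV Q \<and> maximal_symplectic_subspace scaleV Q U" for Q U
    using form_space.maximal_symplectic_dim[OF V.form_space] that by blast

  \<comment> \<open>An odd \<open>d\<close> makes \<open>n\<close> even and at least 4, so
    \<open>n\<close> is 4 or already exceeds 5.\<close>
  have ge5: "n \<ge> 5 \<or> n = 4 \<and> symplectic scaleV Q"
    if "n = d + 3" "odd d" "n = 4 \<longrightarrow> symplectic scaleV Q" for d Q
    using that by (cases "n = 4") (auto elim!: oddE)

  show ?thesis
  proof (intro conjI allI impI, goal_cases)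
    case (1 Q) then show ?case by (rule diagonal)
  next
    case (2 Q Q' b b' a a') then show ?case using classification by blast
  next
    case 3 show ?case by (rule V.card_form_classes)
  next
    case (4 Q U) then show ?case by (rule maximal)
  next
    case (5 d Q P L) then show ?case using nondegenerate by blast
  next
    case (6 d Q P L) then show ?case using nondegenerate by blast
  next
    case (7 d G) then show ?case using transport by blast
  next
    case (8 d Q Q') then show ?case using odd_isometric by simp
  next
    case (9 d Q G) then show ?case using odd_transport by simp
  next
    case (10 d Q P L P' L') then show ?case by (intro odd_isomorphic) simp_all
  next
    case (11 d Q) then show ?case by (intro odd_norms)
  next
    case (12 d) then show ?case by (intro V.card_nondegenerate_classes_odd) simp_all
  next
    case (13 d Q Q' c) then show ?case using even_not_isometric by simp
  next
    case (14 d Q) then show ?case using even_isometric by simp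
  next
    case (15 d) then show ?case by (intro V.symplectic_form_classes) simp
  next
    case (16 d Q) then show ?case using exists_four by blast
  next
    case (17 d Q) then show ?case using exists_nondegenerate by blast
  next
    case (18 d Q P L) then show ?case by (intro norms_multiple)
  next
    case (19 d Q P L P' L') then show ?case by (intro even_isomorphic) simp_all
  next
    case (20 d Q) then show ?case using even_norms ge5 by blast
  next
    case (21 d) then show ?case by (intro V.card_nondegenerate_classes_even_large) simp_all
  next
    case (22 d) then show ?case by (intro V.card_nondegenerate_classes_four)
  qed
qed

end
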